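(* Let $C,\varepsilon>0$ be positive real numbers. Then there exists $n_0$ such that for every $n\ge n_0$ and every $C$-Ramsey graph $G$ on $n$ vertices, \[|\Phi(G)|\ge n^{2-\varepsilon},\] where $\Phi(G)=\{e(H): H \text{ is an induced subgraph of } G\}$.
   Context: All logarithms are base $2$. A set of vertices of a graph is homogeneous if it induces a clique or an independent set; $\hom(G)$ denotes the size of the largest homogeneous set of $G$. For $C>0$, a graph $G$ on $n$ vertices is $C$-Ramsey if $\hom(G)\le C\log n$. For a graph $H$, $e(H)$ denotes its number of edges. *)

theory Defs
  imports Complex_Main "HOL-Library.Ramsey"
begin

text \<open>
  A finite simple graph is a finite vertex set together with a set of two-element subsets of it.
  \<^const>\<open>clique\<close> and \<^const>\<open>indep\<close> are the notions of \<^theory>\<open>HOL-Library.Ramsey\<close>; they do not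
  themselves require their first argument to consist of vertices of the graph.
\<close>

locale simple_graph =
  fixes V :: "'a set" and E :: "'a set set"
  assumes finite_verts: "finite V"
    and edges_subset: "E \<subseteq> [V]\<^bsup>2\<^esup>"

definition homogeneous :: "'a set \<Rightarrow> 'a set set \<Rightarrow> 'a set \<Rightarrow> bool" where
  "homogeneous V E S \<longleftrightarrow> S \<subseteq> V \<and> (clique S E \<or> indep S E)"

text \<open>
  For finite \<open>V\<close> the maximum below is over a finite set that is nonempty, because the empty set is
  homogeneous.
\<close>

definition hom_number :: "'a set \<Rightarrow> 'a set set \<Rightarrow> nat" where
  "hom_number V E = Max {card S | S. homogeneous V E S}"

definition ramsey_graph :: "real \<Rightarrow> 'a set \<Rightarrow> 'a set set \<Rightarrow> bool" where
  "ramsey_graph C V E \<longleftrightarrow> real (hom_number V E) \<le> C * log 2 (real (card V))"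

definition is_induced_subgraph :: "'a set \<Rightarrow> 'a set set \<Rightarrow> 'a set \<Rightarrow> 'a set set \<Rightarrow> bool" where
  "is_induced_subgraph W F V E \<longleftrightarrow> W \<subseteq> V \<and> F = {e \<in> E. e \<subseteq> W}"

definition induced_sizes :: "'a set \<Rightarrow> 'a set set \<Rightarrow> nat set" (\<open>\<Phi>\<close>) where
  "\<Phi> V E = {card F | W F. is_induced_subgraph W F V E}"

end

theory Submission
  imports Defs "HOL-Analysis.Convex"
begin

text \<open>
  Up to factors \<open>n powr o(1)\<close>, the edge counts are produced by a mixed radix system on four scales.
  A greedy chain \<open>T\<^sub>0 \<subset> T\<^sub>1 \<subset> \<dots>\<close>, in which every new vertex has almost linear degree, provides
  about \<open>n\<close> base sets whose edge counts are about \<open>n\<close> apart. To these we add random sets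
  \<open>U\<^sub>1 \<subseteq> A\<^sub>1\<close> and \<open>U\<^sub>2 \<subseteq> A\<^sub>2\<close>. In a Ramsey graph most pairs of vertices have almost linearly many
  neighbours not in common, so by the Littlewood--Offord bound the degrees of the vertices of a set
  \<open>C\<close> into \<open>T\<^sub>k \<union> U\<^sub>2\<close> take about \<open>sqrt n\<close> values within a window of length about \<open>sqrt n\<close>. Swapping
  vertices of low degree of \<open>C\<close> for vertices of high degree, one pair at a time, gives about \<open>sqrt n\<close>
  steps of length about \<open>sqrt n\<close>. Finally the degrees of the vertices \<open>x\<close> of a set \<open>X\<close> again take about
  \<open>sqrt n\<close> values close together, and we add one such \<open>x\<close>.

  The swaps depend on \<open>U\<^sub>2\<close> but not on \<open>U\<^sub>1\<close>, which leaves \<open>U\<^sub>1\<close> free for the last step; \<open>A\<^sub>1\<close> is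
  slightly smaller than \<open>A\<^sub>2\<close>, so that the fluctuations caused by \<open>U\<^sub>1\<close> do not spoil the swaps.
\<close>

section \<open>Random subsets by counting\<close>

text \<open>Cauchy-Schwarz over the fibres of \<open>g\<close>: coincidences are counted by the sum
  of the squared fibre sizes. This turns a scarcity of coincidences into many values.\<close>

lemma card_square_le_image_coincidences:
  assumes "finite Z"
  shows "(card Z)\<^sup>2 \<le> card (g ` Z) * card {(x, x'). x \<in> Z \<and> x' \<in> Z \<and> g x = g x'}"
proof -
  let ?c = "\<lambda>v. card {x \<in> Z. g x = v}"
  have "card Z = (\<Sum>v\<in>g ` Z. ?c v)"
    using sum.image_gen[OF assms, of "\<lambda>_. 1::nat" g] by simp
  moreover have "card {(x, x'). x \<in> Z \<and> x' \<in> Z \<and> g x = g x'} = (\<Sum>v\<in>g ` Z. (?c v)\<^sup>2)"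
  proof -
    have "{(x, x'). x \<in> Z \<and> x' \<in> Z \<and> g x = g x'}
        = (\<Union>v\<in>g ` Z. {x \<in> Z. g x = v} \<times> {x \<in> Z. g x = v})" by auto
    also have "card \<dots> = (\<Sum>v\<in>g ` Z. card ({x \<in> Z. g x = v} \<times> {x \<in> Z. g x = v}))"
      using assms by (intro card_UN_disjoint) auto
    finally show ?thesis by (simp add: card_cartesian_product power2_eq_square)
  qed
  moreover have "(\<Sum>v\<in>g ` Z. real (?c v))\<^sup>2 \<le> (\<Sum>v\<in>g ` Z. (real (?c v))\<^sup>2) * real (card (g ` Z))"
    by (rule sum_squared_le_sum_of_squares)
  ultimately have "real ((card Z)\<^sup>2)
      \<le> real (card (g ` Z) * card {(x, x'). x \<in> Z \<and> x' \<in> Z \<and> g x = g x'})"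
    by (simp add: mult.commute)
  then show ?thesis by (simp only: of_nat_le_iff)
qed

section \<open>Anticoncentration of the intersection with a random subset\<close>

text \<open>The squared form with the factor \<open>2 * k + 1\<close> stays within the naturals and
  closes under induction, because the ratio of consecutive terms reduces to
  \<open>(2 * k + 1) * (2 * k + 3) \<le> 4 * (Suc k)\<^sup>2\<close>.\<close>

lemma central_binomial_upper_bound: "((2 * k) choose k)\<^sup>2 * (2 * k + 1) \<le> 16 ^ k"
proof (induction k)
  case (Suc k)
  let ?b = "(2 * k) choose k" and ?b' = "(2 * Suc k) choose Suc k"
  have 0: "Suc (Suc (2*k)) choose Suc k = (Suc (2*k) choose k) + (Suc (2*k) choose Suc k)"
    by simp
  have 1: "(Suc (2*k) choose k) = (Suc (2*k) choose Suc k)"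
    using binomial_symmetric[of k "Suc (2*k)"] by simp
  have 2: "Suc k * (Suc (2*k) choose Suc k) = Suc (2*k) * ?b"
    by (rule Suc_times_binomial)
  have b: "Suc k * ?b' = 2 * (2 * k + 1) * ?b"
    using 0 1 2 by (simp add: algebra_simps)
  have "(Suc k)\<^sup>2 * (?b'\<^sup>2 * (2 * Suc k + 1)) = (Suc k * ?b')\<^sup>2 * (2 * Suc k + 1)"
    by (simp only: power_mult_distrib mult.assoc)
  also have "\<dots> = 4 * ((2 * k + 1) * (2 * k + 3)) * (?b\<^sup>2 * (2 * k + 1))"
    unfolding b by (simp add: power2_eq_square algebra_simps)
  also have "\<dots> \<le> 4 * (4 * (Suc k)\<^sup>2) * 16 ^ k"
  proof -
    have A: "(2 * k + 1) * (2 * k + 3) \<le> 4 * (Suc k)\<^sup>2"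
      by (simp add: power2_eq_square algebra_simps)
    show ?thesis by (rule mult_le_mono[OF mult_le_mono[OF le_refl A] Suc.IH])
  qed
  also have "\<dots> = (Suc k)\<^sup>2 * 16 ^ Suc k" by simp
  finally show ?case by (simp only: mult_le_cancel1) simp
qed simp

text \<open>The middle coefficient dominates its row, so only that one has to be estimated; squaring
  leads back to natural numbers.\<close>

lemma binomial_sqrt_upper_bound: "real (m choose i) * sqrt (real m) \<le> 2 ^ m"
proof -
  have sq: "(m choose (m div 2))\<^sup>2 * m \<le> 4 ^ m"
  proof (cases "even m")
    case True
    then obtain k where k: "m = 2 * k" by auto
    have "(m choose (m div 2))\<^sup>2 * m \<le> ((2 * k) choose k)\<^sup>2 * (2 * k + 1)"
      using k by simp
    also have "\<dots> \<le> 16 ^ k" by (rule central_binomial_upper_bound)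
    finally show ?thesis using k by (simp add: power_mult)
  next
    \<comment> \<open>The middle coefficient of an odd row is half the central coefficient of the
      next row.\<close>
    case False
    then obtain k where k: "m = 2 * k + 1" using oddE by blast
    have "(2 * Suc k) choose Suc k = (Suc (2*k) choose k) + (Suc (2*k) choose Suc k)"
      by simp
    moreover have "(Suc (2*k) choose k) = (Suc (2*k) choose Suc k)"
      using binomial_symmetric[of k "Suc (2*k)"] by simp
    ultimately have "(2 * Suc k) choose Suc k = 2 * (m choose k)" using k by simp
    then have "4 * ((m choose k)\<^sup>2 * (2 * Suc k + 1)) \<le> 16 ^ Suc k"
      using central_binomial_upper_bound[of "Suc k"] by (simp add: power_mult_distrib)
    moreover have "(16::nat) ^ Suc k = 4 * 4 ^ m"
      using k by (simp add: power_mult)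
    ultimately have "(m choose k)\<^sup>2 * (2 * Suc k + 1) \<le> 4 ^ m" by simp
    moreover have "(m choose k)\<^sup>2 * m \<le> (m choose k)\<^sup>2 * (2 * Suc k + 1)" using k by simp
    moreover have "m div 2 = k" using k by simp
    ultimately show ?thesis using le_trans by simp
  qed
  have "(real (m choose i) * sqrt (real m))\<^sup>2 = real ((m choose i)\<^sup>2 * m)"
    by (simp add: power_mult_distrib)
  also have "\<dots> \<le> real ((m choose (m div 2))\<^sup>2 * m)"
    by (intro of_nat_mono mult_right_mono power_mono binomial_maximum) auto
  also have "\<dots> \<le> real (4 ^ m)" using sq by (rule of_nat_mono)
  also have "\<dots> = (2 ^ m)\<^sup>2" by (simp add: power2_eq_square flip: power_mult_distrib)
  finally show ?thesis by (rule power2_le_imp_le) simp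
qed

text \<open>The trace \<open>U \<inter> D\<close> and the rest \<open>U - D\<close> are chosen
  independently.\<close>

lemma card_subsets_meeting:
  assumes "finite A" "D \<subseteq> A"
  shows "card {U \<in> Pow A. card (U \<inter> D) = i} = (card D choose i) * 2 ^ (card A - card D)"
proof -
  have fD: "finite D" using assms finite_subset by blast
  have "bij_betw (\<lambda>(X, Y). X \<union> Y) ({X. X \<subseteq> D \<and> card X = i} \<times> Pow (A - D))
      {U \<in> Pow A. card (U \<inter> D) = i}"
    unfolding bij_betw_def
  proof
    show "inj_on (\<lambda>(X, Y). X \<union> Y) ({X. X \<subseteq> D \<and> card X = i} \<times> Pow (A - D))"
      by (auto simp: inj_on_def)
    show "(\<lambda>(X, Y). X \<union> Y) ` ({X. X \<subseteq> D \<and> card X = i} \<times> Pow (A - D))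
        = {U \<in> Pow A. card (U \<inter> D) = i}"
    proof (intro equalityI subsetI)
      fix U assume "U \<in> (\<lambda>(X, Y). X \<union> Y) ` ({X. X \<subseteq> D \<and> card X = i} \<times> Pow (A - D))"
      then obtain X Y where XY: "X \<subseteq> D" "card X = i" "Y \<subseteq> A - D" "U = X \<union> Y" by auto
      moreover have "U \<inter> D = X" using XY by auto
      ultimately show "U \<in> {U \<in> Pow A. card (U \<inter> D) = i}" using assms by auto
    next
      fix U assume "U \<in> {U \<in> Pow A. card (U \<inter> D) = i}"
      then have "U = (\<lambda>(X, Y). X \<union> Y) (U \<inter> D, U - D)"
          "(U \<inter> D, U - D) \<in> {X. X \<subseteq> D \<and> card X = i} \<times> Pow (A - D)" by auto
      then show "U \<in> (\<lambda>(X, Y). X \<union> Y) ` ({X. X \<subseteq> D \<and> card X = i} \<times> Pow (A - D))"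
        by (rule image_eqI)
    qed
  qed
  then have "card {U \<in> Pow A. card (U \<inter> D) = i}
      = card ({X. X \<subseteq> D \<and> card X = i} \<times> Pow (A - D))"
    by (simp add: bij_betw_same_card)
  also have "\<dots> = (card D choose i) * 2 ^ (card A - card D)"
    using assms fD by (simp add: card_cartesian_product n_subsets card_Pow card_Diff_subset)
  finally show ?thesis .
qed

text \<open>
  Complementing \<open>U\<close> inside \<open>N' - N\<close> turns the difference of the two counts into the size of the
  intersection with the symmetric difference, up to a constant.
\<close>

lemma card_subsets_fixed_difference:
  assumes "finite A"
  shows "real (card {U \<in> Pow A. int (card (U \<inter> N)) - int (card (U \<inter> N')) = y})
      * sqrt (real (card (A \<inter> ((N - N') \<union> (N' - N))))) \<le> 2 ^ card A"
proof -
  define P where "P = A \<inter> (N - N')"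
  define Q where "Q = A \<inter> (N' - N)"
  define D where "D = A \<inter> ((N - N') \<union> (N' - N))"
  have fin: "finite P" "finite Q" "finite D" using assms by (auto simp: P_def Q_def D_def)
  have DA: "D \<subseteq> A" by (auto simp: D_def)
  define \<phi> where "\<phi> U = (U - Q) \<union> (Q - U)" for U
  have inj: "inj_on \<phi> (Pow A)" by (auto simp: inj_on_def \<phi>_def set_eq_iff)
  have key: "card (\<phi> U \<inter> D) = nat (y + int (card Q))"
    if U: "U \<subseteq> A" "int (card (U \<inter> N)) - int (card (U \<inter> N')) = y" for U
  proof -
    have fU: "finite U" using U assms finite_subset by blast
    have "card (U \<inter> N) = card (U \<inter> P) + card (U \<inter> (N \<inter> N'))"
      using U fU by (subst card_Un_disjoint[symmetric])
        (auto simp: P_def intro!: arg_cong[where f = card])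
    moreover have "card (U \<inter> N') = card (U \<inter> Q) + card (U \<inter> (N \<inter> N'))"
      using U fU by (subst card_Un_disjoint[symmetric])
        (auto simp: Q_def intro!: arg_cong[where f = card])
    moreover have "card (\<phi> U \<inter> D) = card (U \<inter> P) + card (Q - U)"
      using fU fin by (subst card_Un_disjoint[symmetric])
        (auto simp: P_def Q_def D_def \<phi>_def intro!: arg_cong[where f = card])
    moreover have "card Q = card (U \<inter> Q) + card (Q - U)"
      using fin by (subst card_Un_disjoint[symmetric]) (auto intro!: arg_cong[where f = card])
    ultimately show ?thesis using U(2) by linarith
  qed
  let ?S = "{U \<in> Pow A. int (card (U \<inter> N)) - int (card (U \<inter> N')) = y}"
  let ?i = "nat (y + int (card Q))"
  have "card ?S = card (\<phi> ` ?S)"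
    by (rule card_image[symmetric]) (rule inj_on_subset[OF inj], auto)
  also have "\<dots> \<le> card {U \<in> Pow A. card (U \<inter> D) = ?i}"
    using assms key by (intro card_mono) (auto simp: \<phi>_def Q_def)
  also have "\<dots> = (card D choose ?i) * 2 ^ (card A - card D)"
    using assms DA by (rule card_subsets_meeting)
  finally have "real (card ?S) * sqrt (card D)
      \<le> real ((card D choose ?i) * 2 ^ (card A - card D)) * sqrt (card D)"
    by (intro mult_right_mono of_nat_mono) auto
  also have "\<dots> = (real (card D choose ?i) * sqrt (card D)) * 2 ^ (card A - card D)" by simp
  also have "\<dots> \<le> 2 ^ card D * 2 ^ (card A - card D)"
    by (intro mult_right_mono binomial_sqrt_upper_bound) auto
  also have "\<dots> = 2 ^ card A"
    using DA assms by (simp add: card_mono flip: power_add)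
  finally show ?thesis by (simp add: D_def)
qed

section \<open>Concentration of degrees into a random subset\<close>

text \<open>A weak form of \<open>cosh s \<le> exp (s\<^sup>2 / 2)\<close>; on the unit interval the
  quadratic upper bound for \<open>exp\<close> suffices to prove it.\<close>

lemma exp_plus_exp_minus_le:
  fixes s :: real
  assumes "0 \<le> s" "s \<le> 1"
  shows "exp s + exp (- s) \<le> 2 * exp (s\<^sup>2)"
proof -
  have "exp s \<le> 1 + s + s\<^sup>2" using assms by (rule exp_bound)
  moreover have "exp (- s) \<le> 1 - s + s\<^sup>2"
  proof -
    \<comment> \<open>The product equals \<open>1 + s ^ 3\<close>.\<close>
    have "1 \<le> (1 + s) * (1 - s + s\<^sup>2)"
      using assms by (simp add: algebra_simps power2_eq_square)
    also have "\<dots> \<le> exp s * (1 - s + s\<^sup>2)"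
      using assms by (intro mult_right_mono exp_ge_add_one_self) (auto intro: add_nonneg_nonneg)
    finally show ?thesis by (simp add: exp_minus field_simps)
  qed
  moreover have "1 + s\<^sup>2 \<le> exp (s\<^sup>2)" by (rule exp_ge_add_one_self)
  ultimately show ?thesis by linarith
qed

text \<open>The exponent is \<open>s\<close> times a sum of independent random signs over
  \<open>A \<inter> N\<close>, so the sum factorizes, and each element of \<open>A\<close>
  contributes a factor of at most \<open>2 * exp (s\<^sup>2)\<close>.\<close>

lemma sum_Pow_exp_deviation_le:
  fixes s :: real
  assumes "finite A" "\<bar>s\<bar> \<le> 1"
  shows "(\<Sum>U\<in>Pow A. exp (s * (2 * real (card (U \<inter> N)) - real (card (A \<inter> N)))))
      \<le> 2 ^ card A * exp (s\<^sup>2 * real (card A))"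
  using assms(1)
proof (induction A)
  case (insert a A)
  let ?f = "\<lambda>A U. exp (s * (2 * real (card (U \<inter> N)) - real (card (A \<inter> N))))"
  have "(\<Sum>U\<in>Pow (insert a A). ?f (insert a A) U)
      = (\<Sum>U\<in>Pow A. ?f (insert a A) U) + (\<Sum>U\<in>Pow A. ?f (insert a A) (insert a U))"
  proof -
    have "inj_on (insert a) (Pow A)" using insert.hyps by (auto simp: inj_on_def)
    then show ?thesis
      using insert.hyps unfolding Pow_insert
      by (subst sum.union_disjoint) (auto simp: sum.reindex)
  qed
  also have "\<dots> = (\<Sum>U\<in>Pow A. ?f (insert a A) U + ?f (insert a A) (insert a U))"
    by (simp add: sum.distrib)
  also have "\<dots> \<le> (\<Sum>U\<in>Pow A. (2 * exp (s\<^sup>2)) * ?f A U)"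
  proof (rule sum_mono)
    fix U assume U: "U \<in> Pow A"
    then have aU: "a \<notin> U" "finite U" using insert.hyps finite_subset by auto
    show "?f (insert a A) U + ?f (insert a A) (insert a U) \<le> (2 * exp (s\<^sup>2)) * ?f A U"
    proof (cases "a \<in> N")
      case True
      let ?d = "2 * real (card (U \<inter> N)) - real (card (A \<inter> N))"
      have "?f (insert a A) U = exp (s * ?d + - s)"
        using True insert.hyps aU by (simp add: algebra_simps)
      moreover have "?f (insert a A) (insert a U) = exp (s * ?d + s)"
        using True insert.hyps aU by (simp add: algebra_simps)
      moreover have "exp (s * ?d + - s) + exp (s * ?d + s) = (exp s + exp (- s)) * exp (s * ?d)"
        unfolding exp_add by (simp add: algebra_simps)
      moreover have "exp s + exp (- s) \<le> 2 * exp (s\<^sup>2)"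
        using exp_plus_exp_minus_le[of "\<bar>s\<bar>"] assms by (cases "s \<ge> 0") auto
      ultimately show ?thesis by (simp only:) (rule mult_right_mono, auto)
    next
      case False
      then have "?f (insert a A) U + ?f (insert a A) (insert a U) = 2 * ?f A U" by simp
      moreover have "2 * ?f A U \<le> (2 * exp (s\<^sup>2)) * ?f A U"
        by (intro mult_right_mono) auto
      ultimately show ?thesis by linarith
    qed
  qed
  also have "\<dots> = (2 * exp (s\<^sup>2)) * (\<Sum>U\<in>Pow A. ?f A U)" by (simp add: sum_distrib_left)
  also have "\<dots> \<le> (2 * exp (s\<^sup>2)) * (2 ^ card A * exp (s\<^sup>2 * real (card A)))"
    by (intro mult_left_mono insert.IH) auto
  also have "\<dots> = 2 ^ card (insert a A) * exp (s\<^sup>2 * real (card (insert a A)))"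
    using insert.hyps by (simp add: algebra_simps exp_add)
  finally show ?case .
qed simp

text \<open>Chernoff's method: Markov's inequality for the exponential moment, applied to each tail
  separately.\<close>

lemma card_subsets_large_deviation_le:
  fixes t :: real
  assumes "finite A" "0 < t" "t \<le> real (card A)"
  shows "real (card {U \<in> Pow A. t < \<bar>2 * real (card (U \<inter> N)) - real (card (A \<inter> N))\<bar>})
      \<le> 2 * 2 ^ card A * exp (- (t\<^sup>2 / (4 * real (card A))))"
proof -
  let ?d = "\<lambda>U. 2 * real (card (U \<inter> N)) - real (card (A \<inter> N))"
  let ?n = "real (card A)"
  \<comment> \<open>This \<open>s\<close> minimizes \<open>s\<^sup>2 * ?n - s * t\<close>; the bound
    \<open>t \<le> card A\<close> keeps it in the range of the moment estimate.\<close>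
  define s where "s = t / (2 * ?n)"
  have n: "?n > 0" using assms by linarith
  then have s: "0 < s" "s \<le> 1" using assms by (auto simp: s_def field_simps)
  have sn: "s\<^sup>2 * ?n - s * t = - (t\<^sup>2 / (4 * ?n))"
    using n by (simp add: s_def power2_eq_square field_simps)
  have tail: "real (card {U \<in> Pow A. t < \<sigma> * ?d U}) \<le> 2 ^ card A * exp (- (t\<^sup>2 / (4 * ?n)))"
    if \<sigma>: "\<bar>\<sigma>\<bar> = 1" for \<sigma>
  proof -
    have "real (card {U \<in> Pow A. t < \<sigma> * ?d U}) * exp (s * t)
        = (\<Sum>U\<in>{U \<in> Pow A. t < \<sigma> * ?d U}. exp (s * t))" by simp
    also have "\<dots> \<le> (\<Sum>U\<in>{U \<in> Pow A. t < \<sigma> * ?d U}. exp ((s * \<sigma>) * ?d U))"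
      using s by (intro sum_mono) (auto simp: mult.assoc intro: mult_left_mono)
    also have "\<dots> \<le> (\<Sum>U\<in>Pow A. exp ((s * \<sigma>) * ?d U))"
      using assms by (intro sum_mono2) auto
    also have "\<dots> \<le> 2 ^ card A * exp ((s * \<sigma>)\<^sup>2 * ?n)"
      using s \<sigma> assms by (intro sum_Pow_exp_deviation_le) (auto simp: abs_mult)
    also have "(s * \<sigma>)\<^sup>2 = s\<^sup>2" using \<sigma> by (metis abs_mult mult.right_neutral power2_abs)
    finally have "real (card {U \<in> Pow A. t < \<sigma> * ?d U}) * exp (s * t) * exp (- (s * t))
        \<le> 2 ^ card A * exp (s\<^sup>2 * ?n) * exp (- (s * t))"
      by (intro mult_right_mono) auto
    moreover have "exp (s * t) * exp (- (s * t)) = 1" by (simp add: exp_minus)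
    moreover have "exp (s\<^sup>2 * ?n) * exp (- (s * t)) = exp (- (t\<^sup>2 / (4 * ?n)))"
      using sn by (simp flip: exp_add)
    ultimately show ?thesis by (simp add: mult.assoc)
  qed
  have "{U \<in> Pow A. t < \<bar>?d U\<bar>} \<subseteq> {U \<in> Pow A. t < 1 * ?d U} \<union> {U \<in> Pow A. t < (-1) * ?d U}"
    by auto
  then have "card {U \<in> Pow A. t < \<bar>?d U\<bar>}
      \<le> card {U \<in> Pow A. t < 1 * ?d U} + card {U \<in> Pow A. t < (-1) * ?d U}"
    using assms(1) by (intro order.trans[OF card_mono card_Un_le]) auto
  then show ?thesis using tail[of 1] tail[of "-1"] by simp
qed

section \<open>Few coincidences among random degrees\<close>

text \<open>Coincidences are counted pair by pair. There are at most \<open>\<sigma>\<close>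
  near-twins for each vertex, which are bounded trivially; any other pair coincides for at most a
  fraction \<open>1 / t\<close> of the sets \<open>U\<close>, by the Littlewood--Offord
  bound.\<close>

lemma sum_coincidences_le:
  fixes N :: "'b \<Rightarrow> 'a set" and s :: "'b \<Rightarrow> nat"
  assumes "finite A" "finite Z" "t > 0" "\<kappa> > 0"
    and twins: "\<And>x. x \<in> Z \<Longrightarrow>
      card {x' \<in> Z. card (A \<inter> sym_diff (N x) (N x')) < t\<^sup>2} \<le> \<sigma>"
  shows "(\<Sum>U\<in>Pow A. real (card {(x, x'). x \<in> Z \<and> x' \<in> Z \<and>
        s x + \<kappa> * card (U \<inter> N x) = s x' + \<kappa> * card (U \<inter> N x')}))
    \<le> 2 ^ card A * (real (card Z) * real \<sigma> + (real (card Z))\<^sup>2 / real t)"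
proof -
  let ?eq = "\<lambda>U x x'. s x + \<kappa> * card (U \<inter> N x) = s x' + \<kappa> * card (U \<inter> N x')"
  let ?D = "\<lambda>x x'. A \<inter> sym_diff (N x) (N x')"
  have few: "real (card {U \<in> Pow A. ?eq U x x'}) \<le> 2 ^ card A / real t"
    if "t\<^sup>2 \<le> card (?D x x')" for x x'
  proof -
    \<comment> \<open>A coincidence forces the difference of the two counts to this value. If
      \<open>\<kappa>\<close> does not divide the difference of the shifts, there is no coincidence
      and the inclusion below is trivial.\<close>
    let ?y = "(int (s x') - int (s x)) div int \<kappa>"
    have "{U \<in> Pow A. ?eq U x x'} \<subseteq>
        {U \<in> Pow A. int (card (U \<inter> N x)) - int (card (U \<inter> N x')) = ?y}"
    proof safe
      fix U assume eq: "?eq U x x'"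
      then have "int (s x) + int \<kappa> * int (card (U \<inter> N x))
          = int (s x') + int \<kappa> * int (card (U \<inter> N x'))"
        by (metis of_nat_add of_nat_mult)
      then have "int (s x') - int (s x)
          = int \<kappa> * (int (card (U \<inter> N x)) - int (card (U \<inter> N x')))"
        by (simp add: algebra_simps)
      then show "int (card (U \<inter> N x)) - int (card (U \<inter> N x')) = ?y"
        using \<open>\<kappa> > 0\<close> by simp
    qed
    then have "card {U \<in> Pow A. ?eq U x x'}
        \<le> card {U \<in> Pow A. int (card (U \<inter> N x)) - int (card (U \<inter> N x')) = ?y}"
      using assms by (intro card_mono) auto
    moreover have "real t \<le> sqrt (real (card (?D x x')))"
    proof (rule real_le_rsqrt)
      show "(real t)\<^sup>2 \<le> real (card (?D x x'))"
        using that by (metis of_nat_le_iff of_nat_power)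
    qed
    ultimately have "real (card {U \<in> Pow A. ?eq U x x'}) * real t
        \<le> real (card {U \<in> Pow A. int (card (U \<inter> N x)) - int (card (U \<inter> N x')) = ?y})
          * sqrt (real (card (?D x x')))"
      by (intro mult_mono) auto
    also have "\<dots> \<le> 2 ^ card A" by (rule card_subsets_fixed_difference[OF \<open>finite A\<close>])
    finally show ?thesis using \<open>t > 0\<close> by (simp add: field_simps)
  qed
  have all: "real (card {U \<in> Pow A. ?eq U x x'}) \<le> 2 ^ card A" for x x'
  proof -
    have "card {U \<in> Pow A. ?eq U x x'} \<le> card (Pow A)"
      using assms by (intro card_mono) auto
    then have "card {U \<in> Pow A. ?eq U x x'} \<le> 2 ^ card A"
      using \<open>finite A\<close> by (simp add: card_Pow)
    then have "real (card {U \<in> Pow A. ?eq U x x'}) \<le> real (2 ^ card A)"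
      by (rule of_nat_mono)
    then show ?thesis by simp
  qed
  have row: "(\<Sum>x'\<in>Z. real (card {U \<in> Pow A. ?eq U x x'}))
      \<le> 2 ^ card A * (real \<sigma> + real (card Z) / real t)" if "x \<in> Z" for x
  proof -
    let ?B = "{x' \<in> Z. card (?D x x') < t\<^sup>2}"
    have "(\<Sum>x'\<in>Z. real (card {U \<in> Pow A. ?eq U x x'}))
        = (\<Sum>x'\<in>?B. real (card {U \<in> Pow A. ?eq U x x'}))
          + (\<Sum>x'\<in>Z - ?B. real (card {U \<in> Pow A. ?eq U x x'}))"
      by (subst sum.subset_diff[OF _ \<open>finite Z\<close>, of ?B]) (auto simp: add.commute)
    also have "\<dots> \<le> (\<Sum>x'\<in>?B. 2 ^ card A) + (\<Sum>x'\<in>Z - ?B. 2 ^ card A / real t)"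
      using all few by (intro add_mono sum_mono) auto
    also have "\<dots> = real (card ?B) * 2 ^ card A + real (card (Z - ?B)) * (2 ^ card A / real t)"
      by simp
    also have "\<dots> \<le> real \<sigma> * 2 ^ card A + real (card Z) * (2 ^ card A / real t)"
      using twins[OF that] \<open>finite Z\<close>
      by (intro add_mono mult_right_mono of_nat_mono card_mono) auto
    finally show ?thesis by (simp add: algebra_simps)
  qed
  have "(\<Sum>U\<in>Pow A. real (card {(x, x'). x \<in> Z \<and> x' \<in> Z \<and> ?eq U x x'}))
      = (\<Sum>U\<in>Pow A. \<Sum>x\<in>Z. \<Sum>x'\<in>Z. of_bool (?eq U x x'))"
  proof (rule sum.cong[OF refl])
    fix U
    have "{(x, x'). x \<in> Z \<and> x' \<in> Z \<and> ?eq U x x'} = (SIGMA x:Z. {x' \<in> Z. ?eq U x x'})" by auto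
    then have "real (card {(x, x'). x \<in> Z \<and> x' \<in> Z \<and> ?eq U x x'})
        = (\<Sum>x\<in>Z. real (card {x' \<in> Z. ?eq U x x'}))"
      using \<open>finite Z\<close> by (simp add: card_SigmaI)
    also have "\<dots> = (\<Sum>x\<in>Z. \<Sum>x'\<in>Z. of_bool (?eq U x x'))"
      using \<open>finite Z\<close> by (simp add: of_bool_def sum.If_cases Int_def)
    finally show "real (card {(x, x'). x \<in> Z \<and> x' \<in> Z \<and> ?eq U x x'})
        = (\<Sum>x\<in>Z. \<Sum>x'\<in>Z. of_bool (?eq U x x'))" .
  qed
  also have "\<dots> = (\<Sum>x\<in>Z. \<Sum>x'\<in>Z. \<Sum>U\<in>Pow A. of_bool (?eq U x x'))"
    by (subst sum.swap) (intro sum.cong refl, rule sum.swap)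
  also have "\<dots> = (\<Sum>x\<in>Z. \<Sum>x'\<in>Z. real (card {U \<in> Pow A. ?eq U x x'}))"
    using \<open>finite A\<close> by (simp add: of_bool_def sum.If_cases Int_def)
  also have "\<dots> \<le> (\<Sum>x\<in>Z. 2 ^ card A * (real \<sigma> + real (card Z) / real t))"
    by (intro sum_mono row)
  also have "\<dots> = 2 ^ card A * (real (card Z) * real \<sigma> + (real (card Z))\<^sup>2 / real t)"
    by (simp add: algebra_simps power2_eq_square)
  finally show ?thesis .
qed

text \<open>Restricting to at least half of \<open>\<Omega>\<close> at most doubles an average, so
  some \<open>\<omega>\<close> in \<open>G\<close> has mean at most \<open>2 * B\<close> over
  \<open>I\<close>. By Markov, at most half of the indices then exceed \<open>4 * B\<close>.\<close>

lemma exists_element_small_on_half: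
  fixes F :: "'a \<Rightarrow> 'i \<Rightarrow> real"
  assumes fin: "finite \<Omega>" "finite I" and G: "G \<subseteq> \<Omega>" "card \<Omega> \<le> 2 * card G" "\<Omega> \<noteq> {}"
    and "B > 0" and nonneg: "\<And>\<omega> i. 0 \<le> F \<omega> i"
    and mean: "\<And>i. i \<in> I \<Longrightarrow> (\<Sum>\<omega>\<in>\<Omega>. F \<omega> i) \<le> B * real (card \<Omega>)"
  shows "\<exists>\<omega>\<in>G. card I \<le> 2 * card {i \<in> I. F \<omega> i \<le> 4 * B}"
proof -
  have finG: "finite G" using G fin finite_subset by blast
  have "card \<Omega> > 0" using fin G by (simp add: card_gt_0_iff)
  then have "G \<noteq> {}" using G by auto
  have "\<exists>\<omega>\<in>G. (\<Sum>i\<in>I. F \<omega> i) \<le> 2 * B * real (card I)"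
  proof (rule ccontr)
    assume "\<not> ?thesis"
    then have "(\<Sum>\<omega>\<in>G. 2 * B * real (card I)) < (\<Sum>\<omega>\<in>G. \<Sum>i\<in>I. F \<omega> i)"
      using finG \<open>G \<noteq> {}\<close> by (intro sum_strict_mono) auto
    also have "\<dots> \<le> (\<Sum>\<omega>\<in>\<Omega>. \<Sum>i\<in>I. F \<omega> i)"
      using G fin nonneg by (intro sum_mono2 sum_nonneg) auto
    also have "\<dots> = (\<Sum>i\<in>I. \<Sum>\<omega>\<in>\<Omega>. F \<omega> i)" by (rule sum.swap)
    also have "\<dots> \<le> (\<Sum>i\<in>I. B * real (card \<Omega>))" by (intro sum_mono mean)
    also have "\<dots> = B * real (card I) * real (card \<Omega>)" by simp
    also have "\<dots> \<le> B * real (card I) * real (2 * card G)"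
      using G \<open>B > 0\<close> by (intro mult_left_mono of_nat_mono) auto
    finally show False by (simp add: algebra_simps)
  qed
  then obtain \<omega> where \<omega>: "\<omega> \<in> G" "(\<Sum>i\<in>I. F \<omega> i) \<le> 2 * B * real (card I)" by blast
  let ?H = "{i \<in> I. F \<omega> i \<le> 4 * B}"
  have "4 * B * real (card (I - ?H)) = (\<Sum>i\<in>I - ?H. 4 * B)" by simp
  also have "\<dots> \<le> (\<Sum>i\<in>I - ?H. F \<omega> i)" by (intro sum_mono) auto
  also have "\<dots> \<le> (\<Sum>i\<in>I. F \<omega> i)" using fin nonneg by (intro sum_mono2) auto
  also note \<omega>(2)
  finally have "2 * B * (2 * real (card (I - ?H))) \<le> 2 * B * real (card I)" by (simp add: algebra_simps)
  then have "2 * real (card (I - ?H)) \<le> real (card I)" using \<open>B > 0\<close> by simp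
  then have "2 * card (I - ?H) \<le> card I" by linarith
  moreover have "card I = card ?H + card (I - ?H)"
    using fin by (subst card_Un_disjoint[symmetric]) (auto intro!: arg_cong[where f = card])
  ultimately have "card I \<le> 2 * card ?H" by linarith
  with \<omega>(1) show ?thesis by blast
qed

text \<open>
  A uniformly random subset \<open>U\<close> of \<open>A\<close> has both properties with positive probability: the degrees
  into \<open>U\<close> are concentrated by a union bound, and on a set \<open>Z i\<close> without many near-twins
  coincidences of the shifted degrees are rare, so the shifted degrees take many values.
\<close>

lemma exists_concentrated_subset_many_values:
  fixes N :: "'b \<Rightarrow> 'a set" and s :: "'i \<Rightarrow> 'b \<Rightarrow> nat" and \<delta> :: real
  assumes fin: "finite A" "finite X" "finite I" "finite V"
    and pos: "t > 0" "\<kappa> > 0" "\<sigma> > 0"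
    and twins: "\<And>x. x \<in> X \<Longrightarrow>
      card {x' \<in> X. card (A \<inter> sym_diff (N x) (N x')) < t\<^sup>2} \<le> \<sigma>"
    and Z: "\<And>i. i \<in> I \<Longrightarrow> Z i \<subseteq> X" "\<And>i. i \<in> I \<Longrightarrow> card (Z i) = z" "0 < z" "z \<le> \<sigma> * t"
    and lam: "0 < \<delta>" "\<delta> \<le> real (card A)"
      "4 * real (card V) * exp (- (\<delta>\<^sup>2 / (4 * real (card A)))) \<le> 1"
  shows "\<exists>U\<subseteq>A. (\<forall>v\<in>V. \<bar>2 * real (card (U \<inter> N v)) - real (card (A \<inter> N v))\<bar> \<le> \<delta>) \<and>
      card I \<le> 2 * card {i \<in> I. z \<le> 8 * \<sigma> * card ((\<lambda>x. s i x + \<kappa> * card (U \<inter> N x)) ` Z i)}"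
proof -
  let ?dev = "\<lambda>U v. \<bar>2 * real (card (U \<inter> N v)) - real (card (A \<inter> N v))\<bar>"
  define G where "G = {U \<in> Pow A. \<forall>v\<in>V. ?dev U v \<le> \<delta>}"
  define g where "g i U x = s i x + \<kappa> * card (U \<inter> N x)" for i U x
  define F where "F U i = real (card {(x, x'). x \<in> Z i \<and> x' \<in> Z i \<and> g i U x = g i U x'})" for U i
  \<comment> \<open>The condition \<open>z \<le> \<sigma> * t\<close> makes both terms of the
    expected number of coincidences at most \<open>z * \<sigma>\<close>. The bound
    \<open>4 * B\<close> on the coincidences is the source of the factor
    \<open>8 * \<sigma>\<close>.\<close>
  define B where "B = 2 * real z * real \<sigma>"
  \<comment> \<open>Union bound: the constant 4 in the hypothesis on \<open>\<delta>\<close> makes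
    the sets without concentration at most half of all.\<close>
  have "real (card (Pow A - G)) \<le> real (card (\<Union>v\<in>V. {U \<in> Pow A. \<delta> < ?dev U v}))"
    using fin by (intro of_nat_mono card_mono) (auto simp: G_def not_le)
  also have "\<dots> \<le> real (\<Sum>v\<in>V. card {U \<in> Pow A. \<delta> < ?dev U v})"
    using fin by (intro of_nat_mono card_UN_le)
  also have "\<dots> = (\<Sum>v\<in>V. real (card {U \<in> Pow A. \<delta> < ?dev U v}))" by simp
  also have "\<dots> \<le> (\<Sum>v\<in>V. 2 * 2 ^ card A * exp (- (\<delta>\<^sup>2 / (4 * real (card A)))))"
    using fin lam by (intro sum_mono card_subsets_large_deviation_le) auto
  also have "\<dots> = (4 * real (card V) * exp (- (\<delta>\<^sup>2 / (4 * real (card A))))) * (2 ^ card A / 2)"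
    by simp
  also have "\<dots> \<le> 1 * (2 ^ card A / 2)" using lam by (intro mult_right_mono) auto
  finally have "2 * real (card (Pow A - G)) \<le> 2 ^ card A" by simp
  also have "(2::real) ^ card A = real (card (Pow A))" using fin by (simp add: card_Pow)
  finally have "2 * card (Pow A - G) \<le> card (Pow A)" by linarith
  moreover have "card (Pow A) = card G + card (Pow A - G)"
    using fin by (subst card_Un_disjoint[symmetric])
      (auto simp: G_def intro!: arg_cong[where f = card])
  ultimately have half: "card (Pow A) \<le> 2 * card G" by linarith
  have mean: "(\<Sum>U\<in>Pow A. F U i) \<le> B * real (card (Pow A))" if i: "i \<in> I" for i
  proof -
    have finZ: "finite (Z i)" using Z(1)[OF i] fin finite_subset by blast
    have tw: "card {x' \<in> Z i. card (A \<inter> sym_diff (N x) (N x')) < t\<^sup>2} \<le> \<sigma>"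
      if "x \<in> Z i" for x
    proof -
      have "card {x' \<in> Z i. card (A \<inter> sym_diff (N x) (N x')) < t\<^sup>2}
          \<le> card {x' \<in> X. card (A \<inter> sym_diff (N x) (N x')) < t\<^sup>2}"
        using Z(1)[OF i] fin by (intro card_mono) auto
      also have "\<dots> \<le> \<sigma>" using that Z(1)[OF i] twins by auto
      finally show ?thesis .
    qed
    have "(\<Sum>U\<in>Pow A. F U i)
        \<le> 2 ^ card A * (real (card (Z i)) * real \<sigma> + (real (card (Z i)))\<^sup>2 / real t)"
      unfolding F_def g_def by (intro sum_coincidences_le fin finZ pos tw)
    also have "\<dots> \<le> 2 ^ card A * B"
    proof (rule mult_left_mono)
      have "(real z)\<^sup>2 \<le> real z * real (\<sigma> * t)"
        unfolding power2_eq_square by (intro mult_left_mono of_nat_mono Z) auto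
      then have "(real z)\<^sup>2 / real t \<le> real z * real \<sigma>"
        using pos by (simp add: field_simps)
      then show "real (card (Z i)) * real \<sigma> + (real (card (Z i)))\<^sup>2 / real t \<le> B"
        using Z(2)[OF i] by (simp add: B_def mult.commute)
    qed simp
    finally show ?thesis using fin by (simp add: card_Pow mult.commute)
  qed
  have "\<exists>U\<in>G. card I \<le> 2 * card {i \<in> I. F U i \<le> 4 * B}"
    using fin half mean Z pos
    by (intro exists_element_small_on_half[where \<Omega> = "Pow A"]) (auto simp: G_def F_def B_def)
  then obtain U where U: "U \<in> G" "card I \<le> 2 * card {i \<in> I. F U i \<le> 4 * B}" by blast
  have many: "z \<le> 8 * \<sigma> * card (g i U ` Z i)" if i: "i \<in> I" "F U i \<le> 4 * B" for i
  proof -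
    have finZ: "finite (Z i)" using Z(1)[OF i(1)] fin finite_subset by blast
    have "real (z * z) \<le> real (card (g i U ` Z i)) * F U i"
      using card_square_le_image_coincidences[OF finZ, of "g i U"] Z(2)[OF i(1)]
      unfolding F_def power2_eq_square of_nat_mult[symmetric] by (intro of_nat_mono) simp
    also have "\<dots> \<le> real (card (g i U ` Z i)) * (4 * B)"
      using i by (intro mult_left_mono) auto
    also have "\<dots> = real (z * (8 * \<sigma> * card (g i U ` Z i)))" by (simp add: B_def)
    finally have "z * z \<le> z * (8 * \<sigma> * card (g i U ` Z i))" by (simp only: of_nat_le_iff)
    then show ?thesis using \<open>0 < z\<close> by simp
  qed
  have "card {i \<in> I. F U i \<le> 4 * B} \<le> card {i \<in> I. z \<le> 8 * \<sigma> * card (g i U ` Z i)}"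
    using many fin by (intro card_mono) auto
  then have "card I \<le> 2 * card {i \<in> I. z \<le> 8 * \<sigma> * card (g i U ` Z i)}" using U(2) by linarith
  then show ?thesis using U(1) by (intro exI[of _ U]) (auto simp: G_def g_def)
qed

section \<open>Windows and separated pairs\<close>

text \<open>Pigeonhole on the \<open>b\<close> blocks of length \<open>w\<close> that cover the
  range of \<open>H\<close>.\<close>

lemma exists_window:
  fixes H :: "'b \<Rightarrow> nat"
  assumes "finite C" "b > 0" and H: "\<And>c. c \<in> C \<Longrightarrow> H c < b * w" and z: "z * b \<le> card C"
  shows "\<exists>Z\<subseteq>C. card Z = z \<and> (\<forall>c\<in>Z. \<forall>c'\<in>Z. H c \<le> H c' + w)"
proof -
  let ?D = "\<lambda>i. {c \<in> C. H c div w = i}"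
  have "\<exists>i<b. z \<le> card (?D i)"
  proof (rule ccontr)
    assume "\<not> ?thesis"
    then have lt: "card (?D i) < z" if "i < b" for i using that by auto
    have "C \<subseteq> (\<Union>i<b. ?D i)"
      using H by (auto simp: less_mult_imp_div_less)
    then have "card C \<le> card (\<Union>i<b. ?D i)" using assms by (intro card_mono) auto
    also have "\<dots> \<le> (\<Sum>i<b. card (?D i))" by (intro card_UN_le) auto
    also have "\<dots> < (\<Sum>i<b. z)" using lt \<open>b > 0\<close> by (intro sum_strict_mono) auto
    finally show False using z by (simp add: mult.commute)
  qed
  then obtain i where i: "z \<le> card (?D i)" by blast
  then obtain Z where Z: "Z \<subseteq> ?D i" "card Z = z" by (meson obtain_subset_with_card_n)
  have "H c \<le> H c' + w" if "c \<in> Z" "c' \<in> Z" for c c'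
  proof -
    have c: "c \<in> C" "H c div w = i" "H c' div w = i" using that Z by auto
    then have "w > 0" using H[of c] by (cases w) auto
    then have "H c < i * w + w" using c(2) dividend_less_div_times[of w "H c"] by simp
    moreover have "i * w \<le> H c'" using c(3) div_times_less_eq_dividend[of "H c'" w] by simp
    ultimately show ?thesis by linarith
  qed
  then show ?thesis using Z by blast
qed

lemma strict_sorted_nth_add_le:
  fixes xs :: "nat list"
  assumes "sorted_wrt (<) xs" "i + k < length xs"
  shows "xs ! i + k \<le> xs ! (i + k)"
  using assms(2)
proof (induction k)
  case (Suc k)
  then have "xs ! (i + k) < xs ! (i + Suc k)"
    using assms(1) by (intro sorted_wrt_nth_less) auto
  with Suc show ?case by force
qed simp

text \<open>In the sorted list of the values of \<open>F\<close>, \<open>b i\<close> realizes entry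
  \<open>i\<close> and \<open>a i\<close> the entry \<open>M + R\<close> places later. Distinct
  naturals in increasing order grow by at least 1 per place, which gives the gap; a shift by at
  least \<open>M\<close> keeps the two families disjoint.\<close>

lemma exists_separated_pairs:
  fixes F :: "'b \<Rightarrow> nat"
  assumes "finite C" "2 * M + R \<le> card (F ` C)"
  shows "\<exists>a b :: nat \<Rightarrow> 'b. inj_on a {..<M} \<and> inj_on b {..<M} \<and> a ` {..<M} \<inter> b ` {..<M} = {} \<and>
      (\<forall>i<M. a i \<in> C \<and> b i \<in> C \<and> F (b i) + R \<le> F (a i))"
proof -
  define xs where "xs = sorted_list_of_set (F ` C)"
  have xs: "sorted_wrt (<) xs" "set xs = F ` C" "length xs = card (F ` C)" "distinct xs"
    using assms by (auto simp: xs_def)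
  define g where "g = inv_into C F"
  have g: "g (xs ! i) \<in> C" "F (g (xs ! i)) = xs ! i" if "i < length xs" for i
    using that xs nth_mem[of i xs] by (auto simp: g_def inv_into_into f_inv_into_f)
  define b where "b i = g (xs ! i)" for i
  define a where "a i = g (xs ! (i + (M + R)))" for i
  have Fb: "F (b i) = xs ! i" "b i \<in> C" if "i < M" for i
    using that g assms xs by (auto simp: b_def)
  have Fa: "F (a i) = xs ! (i + (M + R))" "a i \<in> C" if "i < M" for i
    using that g assms xs by (auto simp: a_def)
  have inj_xs: "xs ! i = xs ! j \<longleftrightarrow> i = j" if "i < length xs" "j < length xs" for i j
    using that xs(4) by (simp add: nth_eq_iff_index_eq)
  have "inj_on b {..<M}"
  proof (rule inj_onI)
    fix i j assume "i \<in> {..<M}" "j \<in> {..<M}" "b i = b j"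
    then show "i = j" using Fb(1)[of i] Fb(1)[of j] inj_xs[of i j] assms xs(3) by auto
  qed
  moreover have "inj_on a {..<M}"
  proof (rule inj_onI)
    fix i j assume "i \<in> {..<M}" "j \<in> {..<M}" "a i = a j"
    then show "i = j" using Fa(1)[of i] Fa(1)[of j] inj_xs[of "i + (M + R)" "j + (M + R)"] assms xs(3)
      by auto
  qed
  moreover have "a i \<noteq> b j" if "i < M" "j < M" for i j
  proof
    assume "a i = b j"
    then have "xs ! (i + (M + R)) = xs ! j" using Fa Fb that by metis
    then show False using inj_xs[of "i + (M + R)" j] that assms xs(3) by auto
  qed
  moreover have "F (b i) + R \<le> F (a i)" if "i < M" for i
    using strict_sorted_nth_add_le[OF xs(1), of i "M + R"] that Fa Fb assms xs(3) by auto
  ultimately show ?thesis using Fa Fb by (intro exI[of _ a] exI[of _ b]) auto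
qed

text \<open>Absorbs a constant up to \<open>y\<close> into one spare factor \<open>y\<close>, which
  reduces the later inequalities between monomials to comparing exponents.\<close>

lemma mult_power_le_power:
  fixes y :: nat
  assumes "c \<le> y" "0 < y" "a < b"
  shows "c * y ^ a \<le> y ^ b"
proof -
  have "c * y ^ a \<le> y ^ Suc a" using assms by simp
  also have "\<dots> \<le> y ^ b" using assms by (intro power_increasing) auto
  finally show ?thesis .
qed

section \<open>Ramsey bounds and diverse pairs\<close>

text \<open>
  The weight \<open>f k l = (1/x)^k (1/(1-x))^l\<close> satisfies \<open>f (k-1) l + f k (l-1) = f k l\<close>, so it
  replaces the binomial coefficient in the Erdos--Szekeres recursion. Taking \<open>x\<close> small makes it
  small when \<open>k\<close> is much smaller than \<open>l\<close>.
\<close>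

lemma ramsey_weighted:
  fixes x :: real
  assumes x: "0 < x" "x < 1" and "finite S"
    and "(1 / x) ^ k * (1 / (1 - x)) ^ l \<le> real (card S) + 1"
  shows "(\<exists>I\<subseteq>S. card I = k \<and> indep I E) \<or> (\<exists>K\<subseteq>S. card K = l \<and> clique K E)"
  using assms(3-)
proof (induction "k + l" arbitrary: k l S rule: less_induct)
  case less
  show ?case
  proof (cases "k = 0 \<or> l = 0")
    case True
    then show ?thesis by (auto simp: clique_def indep_def intro!: exI[of _ "{}"])
  next
    case False
    then obtain k' l' where kl: "k = Suc k'" "l = Suc l'" by (meson not0_implies_Suc)
    let ?f = "(1 / x) ^ k * (1 / (1 - x)) ^ l"
    \<comment> \<open>A weight above 1 forces \<open>S\<close> to be nonempty, so there is a vertex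
      to branch on.\<close>
    have big: "1 < ?f"
    proof -
      have "1 < (1 / x) ^ k" "1 < (1 / (1 - x)) ^ l"
        using x kl by (auto intro!: one_less_power simp del: power_Suc)
      then show ?thesis by (rule less_1_mult)
    qed
    then obtain v where v: "v \<in> S" using less.prems by (cases "S = {}") auto
    let ?A = "{w \<in> S - {v}. {v, w} \<in> E}" and ?B = "{w \<in> S - {v}. {v, w} \<notin> E}"
    have "card S = Suc (card (S - {v}))" using card_Suc_Diff1[of S v] v less.prems by simp
    also have "card (S - {v}) = card ?A + card ?B"
      using less.prems by (subst card_Un_disjoint[symmetric]) (auto intro!: arg_cong[where f = card])
    finally have cS: "card S = Suc (card ?A + card ?B)" .
    have fA: "(1 / x) ^ k * (1 / (1 - x)) ^ l' = (1 - x) * ?f"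
      using x kl by (simp add: field_simps)
    have fB: "(1 / x) ^ k' * (1 / (1 - x)) ^ l = x * ?f"
      using x kl by (simp add: field_simps)
    \<comment> \<open>The two weights add up to \<open>?f\<close>, and \<open>card S + 1\<close> is
      \<open>(card ?A + 1) + (card ?B + 1)\<close>, so one side receives its share.\<close>
    have "(1 - x) * ?f \<le> real (card ?A) + 1 \<or> x * ?f \<le> real (card ?B) + 1"
      using less.prems(2) cS by (auto simp: algebra_simps)
    then show ?thesis
    proof
      assume "(1 - x) * ?f \<le> real (card ?A) + 1"
      then have "(\<exists>I\<subseteq>?A. card I = k \<and> indep I E) \<or> (\<exists>K\<subseteq>?A. card K = l' \<and> clique K E)"
        using less.prems kl fA by (intro less.hyps) auto
      then show ?thesis
      proof
        assume "\<exists>K\<subseteq>?A. card K = l' \<and> clique K E"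
        then obtain K where K: "K \<subseteq> ?A" "card K = l'" "clique K E" by blast
        have "finite K" using K less.prems by (auto intro: finite_subset)
        then have "card (insert v K) = l" using K kl by (subst card_insert_disjoint) auto
        moreover have "clique (insert v K) E"
          using K unfolding clique_def by (auto simp: insert_commute)
        ultimately show ?thesis using K v by (intro disjI2 exI[of _ "insert v K"]) auto
      qed blast
    next
      assume "x * ?f \<le> real (card ?B) + 1"
      then have "(\<exists>I\<subseteq>?B. card I = k' \<and> indep I E) \<or> (\<exists>K\<subseteq>?B. card K = l \<and> clique K E)"
        using less.prems kl fB by (intro less.hyps) auto
      then show ?thesis
      proof
        assume "\<exists>I\<subseteq>?B. card I = k' \<and> indep I E"
        then obtain K where K: "K \<subseteq> ?B" "card K = k'" "indep K E" by blast
        have "finite K" using K less.prems by (auto intro: finite_subset)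
        then have "card (insert v K) = k" using K kl by (subst card_insert_disjoint) auto
        moreover have "indep (insert v K) E"
          using K unfolding indep_def by (auto simp: insert_commute)
        ultimately show ?thesis using K v by (intro disjI1 exI[of _ "insert v K"]) auto
      qed blast
    qed
  qed
qed

lemma clique_Compl_iff: "clique K (- E) \<longleftrightarrow> indep K E"
  and indep_Compl_iff: "indep K (- E) \<longleftrightarrow> clique K E"
  by (auto simp: clique_def indep_def)

text \<open>The weighted bound is applied to \<open>E\<close> and to its complement. Each time the
  alternative of size \<open>h + 1\<close> is excluded, which leaves a clique and an independent set
  of size \<open>k\<close> at once.\<close>

lemma clique_and_indep_of_homogeneous_bounded:
  fixes x :: real
  assumes "0 < x" "x < 1" "finite S" "(1 / x) ^ k * (1 / (1 - x)) ^ (h + 1) \<le> real (card S) + 1"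
    and hom: "\<And>K. K \<subseteq> S \<Longrightarrow> clique K E \<or> indep K E \<Longrightarrow> card K \<le> h"
  shows "(\<exists>K\<subseteq>S. card K = k \<and> clique K E) \<and> (\<exists>I\<subseteq>S. card I = k \<and> indep I E)"
proof -
  have no: "card K \<noteq> h + 1" if "K \<subseteq> S" "clique K E \<or> indep K E" for K
    using hom[OF that] by simp
  show ?thesis
    using ramsey_weighted[OF assms(1-4), of E] ramsey_weighted[OF assms(1-4), of "- E"] no
    unfolding clique_Compl_iff indep_Compl_iff by metis
qed

section \<open>Edge counts and diverse neighbourhoods\<close>

context simple_graph
begin

definition nbrs :: "'a \<Rightarrow> 'a set" where
  "nbrs v = {w. {v, w} \<in> E}"

definition num_edges :: "'a set \<Rightarrow> nat" where
  "num_edges W = card {e \<in> E. e \<subseteq> W}"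

lemma finite_edges: "finite E"
  using finite_subset[OF edges_subset] finite_imp_finite_nsets[OF finite_verts] by blast

lemma edge_distinct: "{v, w} \<in> E \<Longrightarrow> v \<noteq> w"
  using edges_subset by (auto simp: nsets_def)

lemma finite_subset_verts: "W \<subseteq> V \<Longrightarrow> finite W"
  using finite_verts finite_subset by blast

lemma num_edges_insert:
  assumes "v \<notin> W"
  shows "num_edges (insert v W) = num_edges W + card (W \<inter> nbrs v)"
proof -
  have "{e \<in> E. e \<subseteq> insert v W} = {e \<in> E. e \<subseteq> W} \<union> (\<lambda>w. {v, w}) ` (W \<inter> nbrs v)"
  proof (intro equalityI subsetI)
    fix e assume e: "e \<in> {e \<in> E. e \<subseteq> insert v W}"
    show "e \<in> {e \<in> E. e \<subseteq> W} \<union> (\<lambda>w. {v, w}) ` (W \<inter> nbrs v)"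
    proof (cases "v \<in> e")
      case True
      have "card e = 2" using e edges_subset by (auto simp: nsets_def)
      then obtain w where "e = {v, w}" "w \<noteq> v" using True by (auto simp: card_2_iff)
      then show ?thesis using e by (auto simp: nbrs_def)
    qed (use e in auto)
  qed (auto simp: nbrs_def)
  moreover have "{e \<in> E. e \<subseteq> W} \<inter> (\<lambda>w. {v, w}) ` (W \<inter> nbrs v) = {}" using assms by auto
  moreover have "finite {e \<in> E. e \<subseteq> W}" "finite ((\<lambda>w. {v, w}) ` (W \<inter> nbrs v))"
    using finite_edges by (auto intro: finite_subset[OF _ finite_edges] simp: nbrs_def)
  moreover have "inj_on (\<lambda>w. {v, w}) (W \<inter> nbrs v)" by (auto simp: inj_on_def doubleton_eq_iff)
  ultimately show ?thesis by (simp add: num_edges_def card_Un_disjoint card_image)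
qed

lemma num_edges_mono: "W \<subseteq> W' \<Longrightarrow> num_edges W \<le> num_edges W'"
  unfolding num_edges_def using finite_edges by (intro card_mono) auto

lemma num_edges_in_induced_sizes: "W \<subseteq> V \<Longrightarrow> num_edges W \<in> \<Phi> V E"
  by (auto simp: induced_sizes_def is_induced_subgraph_def num_edges_def)

lemma finite_induced_sizes: "finite (\<Phi> V E)"
proof -
  have "\<Phi> V E \<subseteq> num_edges ` Pow V"
    by (auto simp: induced_sizes_def is_induced_subgraph_def num_edges_def)
  then show ?thesis using finite_verts by (meson finite_Pow_iff finite_imageI finite_subset)
qed

lemma card_inter_nbrs_le: "finite W \<Longrightarrow> card (W \<inter> nbrs v) \<le> card W"
  by (intro card_mono) auto

lemma num_edges_Un_le:
  assumes "finite S" "finite W" "card (W \<union> S) \<le> b"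
  shows "num_edges (W \<union> S) \<le> num_edges W + card S * b"
  using assms
proof (induction S)
  case (insert v S)
  have "card (W \<union> S) \<le> card (W \<union> insert v S)" using insert by (intro card_mono) auto
  then have b: "card (W \<union> S) \<le> b" using insert by simp
  then have IH: "num_edges (W \<union> S) \<le> num_edges W + card S * b" using insert by simp
  show ?case
  proof (cases "v \<in> W \<union> S")
    case True
    then have "W \<union> insert v S = W \<union> S" by auto
    then show ?thesis using IH insert by simp
  next
    case False
    then have "num_edges (W \<union> insert v S) = num_edges (W \<union> S) + card ((W \<union> S) \<inter> nbrs v)"
      using num_edges_insert[of v "W \<union> S"] by simp
    moreover have "card ((W \<union> S) \<inter> nbrs v) \<le> b"
      using card_inter_nbrs_le[of "W \<union> S" v] b insert by simp
    ultimately show ?thesis using IH insert by simp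
  qed
qed simp

text \<open>
  If no large pair is diverse, then any large \<open>W\<close> contains \<open>\<sigma>\<close> near-twins and a large set \<open>A'\<close> all of
  whose vertices see the twins in the same way. The twins contain both a clique and an independent
  set of size \<open>c\<close>, one of which extends any clique or any independent set found in \<open>A'\<close>.
\<close>

lemma clique_or_indep_of_no_diverse_pair:
  assumes both: "\<And>S. S \<subseteq> V \<Longrightarrow> card S = \<sigma> \<Longrightarrow>
      (\<exists>K\<subseteq>S. card K = c \<and> clique K E) \<and> (\<exists>I\<subseteq>S. card I = c \<and> indep I E)"
    and "\<sigma> * \<tau> \<le> 2 * w"
    and none: "\<And>X A. X \<subseteq> V0 \<Longrightarrow> A \<subseteq> V0 \<Longrightarrow> X \<inter> A = {} \<Longrightarrow> w \<le> card X \<Longrightarrow> w \<le> card A \<Longrightarrow>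
      \<exists>x\<in>X. \<sigma> < card {x' \<in> X. card (A \<inter> sym_diff (nbrs x) (nbrs x')) < \<tau>}"
    and "V0 \<subseteq> V" "W \<subseteq> V0" "8 ^ (a + b) * w \<le> card W"
  shows "(\<exists>K\<subseteq>W. card K = a * c \<and> clique K E) \<or> (\<exists>I\<subseteq>W. card I = b * c \<and> indep I E)"
  using assms(5-)
proof (induction "a + b" arbitrary: a b W rule: less_induct)
  case less
  show ?case
  proof (cases "a = 0 \<or> b = 0")
    case True
    then show ?thesis by (auto simp: clique_def indep_def intro!: exI[of _ "{}"])
  next
    case False
    \<comment> \<open>The half \<open>A\<close> of \<open>W\<close> has at least
      \<open>4 * u\<close> vertices. Deleting the differences with \<open>\<sigma>\<close>
      near-twins costs at most \<open>\<sigma> * \<tau> \<le> 2 * u\<close>, and splitting the rest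
      by adjacency to \<open>x\<close> leaves \<open>u\<close>, enough to recurse with one parameter
      lowered.\<close>
    define u where "u = 8 ^ (a + b - 1) * w"
    have WV: "W \<subseteq> V" using less.prems \<open>V0 \<subseteq> V\<close> by blast
    have finW: "finite W" using WV by (rule finite_subset_verts)
    have "8 * u = 8 ^ (a + b) * w" using False by (cases "a + b") (auto simp: u_def)
    then have cW: "8 * u \<le> card W" using less.prems by simp
    have wu: "w \<le> u" by (simp add: u_def)
    obtain X where X: "X \<subseteq> W" "card X = card W div 2"
      by (rule obtain_subset_with_card_n[OF div_le_dividend])
    define A where "A = W - X"
    have cA: "card A = card W - card W div 2"
      using X finW by (metis A_def card_Diff_subset finite_subset)
    let ?sd = "\<lambda>x x'. sym_diff (nbrs x) (nbrs x')"
    have "\<exists>x\<in>X. \<sigma> < card {x' \<in> X. card (A \<inter> ?sd x x') < \<tau>}"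
    proof (rule none)
      show "X \<subseteq> V0" "A \<subseteq> V0" "X \<inter> A = {}" using X less.prems(1) by (auto simp: A_def)
      show "w \<le> card X" "w \<le> card A" using X(2) cA cW wu by linarith+
    qed
    then obtain x where x: "x \<in> X" "\<sigma> < card {x' \<in> X. card (A \<inter> ?sd x x') < \<tau>}" by blast
    then obtain S where S: "S \<subseteq> {x' \<in> X. card (A \<inter> ?sd x x') < \<tau>}" "card S = \<sigma>"
      by (meson less_imp_le obtain_subset_with_card_n)
    have SW: "S \<subseteq> W" "S \<inter> A = {}" using S X by (auto simp: A_def)
    have finS: "finite S" using SW finW finite_subset by blast
    have finA: "finite A" using finW by (simp add: A_def)
    define A1 where "A1 = A - (\<Union>s\<in>S. A \<inter> ?sd x s)"
    have "card (\<Union>s\<in>S. A \<inter> ?sd x s) \<le> (\<Sum>s\<in>S. card (A \<inter> ?sd x s))"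
      using finS by (rule card_UN_le)
    also have "\<dots> \<le> (\<Sum>s\<in>S. \<tau>)" using S by (intro sum_mono) auto
    also have "\<dots> \<le> 2 * u" using S assms(2) wu by simp
    finally have "card A \<le> card A1 + 2 * u"
      using finA diff_card_le_card_Diff[of "\<Union>s\<in>S. A \<inter> ?sd x s" A] finS
      by (force simp: A1_def)
    then have "2 * u \<le> card A1" using cA cW by linarith
    moreover have "card A1 = card (A1 \<inter> nbrs x) + card (A1 - nbrs x)"
      using finA by (subst card_Un_disjoint[symmetric])
        (auto simp: A1_def intro!: arg_cong[where f = card])
    ultimately have "u \<le> card (A1 \<inter> nbrs x) \<or> u \<le> card (A1 - nbrs x)" by linarith
    then show ?thesis
    proof
      assume u: "u \<le> card (A1 \<inter> nbrs x)"
      \<comment> \<open>Outside the deleted differences, every twin in \<open>S\<close> has the same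
        adjacencies as \<open>x\<close>.\<close>
      have adj: "{s, y} \<in> E" if "s \<in> S" "y \<in> A1 \<inter> nbrs x" for s y
        using that by (auto simp: A1_def nbrs_def)
      have "(\<exists>K\<subseteq>A1 \<inter> nbrs x. card K = (a - 1) * c \<and> clique K E) \<or>
          (\<exists>I\<subseteq>A1 \<inter> nbrs x. card I = b * c \<and> indep I E)"
        using False u less.prems by (intro less.hyps) (auto simp: A1_def A_def u_def)
      then show ?thesis
      proof
        assume "\<exists>K\<subseteq>A1 \<inter> nbrs x. card K = (a - 1) * c \<and> clique K E"
        then obtain K where K: "K \<subseteq> A1 \<inter> nbrs x" "card K = (a - 1) * c" "clique K E" by blast
        obtain K' where K': "K' \<subseteq> S" "card K' = c" "clique K' E"
          using both[of S] S SW WV by blast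
        have "K' \<inter> K = {}" using K K' SW by (auto simp: A1_def)
        moreover have "finite K" "finite K'" using K K' finA finS
          by (auto intro: finite_subset simp: A1_def)
        ultimately have "card (K' \<union> K) = a * c"
          using K K' False by (cases a) (auto simp: card_Un_disjoint)
        moreover have "clique (K' \<union> K) E"
          using K K' by (intro clique_Un ballI impI adj) auto
        moreover have "K' \<union> K \<subseteq> W" using K K' SW by (auto simp: A1_def A_def)
        ultimately show ?thesis by blast
      qed (auto simp: A1_def A_def)
    next
      assume u: "u \<le> card (A1 - nbrs x)"
      \<comment> \<open>Non-adjacency is put as adjacency in \<open>- E\<close>, so that the union
        rule for cliques also serves independent sets.\<close>
      have nadj: "{s, y} \<in> - E" if "s \<in> S" "y \<in> A1 - nbrs x" for s y
        using that by (auto simp: A1_def nbrs_def)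
      have "(\<exists>K\<subseteq>A1 - nbrs x. card K = a * c \<and> clique K E) \<or>
          (\<exists>I\<subseteq>A1 - nbrs x. card I = (b - 1) * c \<and> indep I E)"
        using False u less.prems by (intro less.hyps) (auto simp: A1_def A_def u_def)
      then show ?thesis
      proof
        assume "\<exists>I\<subseteq>A1 - nbrs x. card I = (b - 1) * c \<and> indep I E"
        then obtain K where K: "K \<subseteq> A1 - nbrs x" "card K = (b - 1) * c" "indep K E" by blast
        obtain K' where K': "K' \<subseteq> S" "card K' = c" "indep K' E"
          using both[of S] S SW WV by blast
        have "K' \<inter> K = {}" using K K' SW by (auto simp: A1_def)
        moreover have "finite K" "finite K'" using K K' finA finS
          by (auto intro: finite_subset simp: A1_def)
        ultimately have "card (K' \<union> K) = b * c"
          using K K' False by (cases b) (auto simp: card_Un_disjoint)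
        moreover have "indep (K' \<union> K) E"
          unfolding clique_Compl_iff[symmetric]
          using K K' by (intro clique_Un ballI impI nadj) (auto simp: clique_Compl_iff)
        moreover have "K' \<union> K \<subseteq> W" using K K' SW by (auto simp: A1_def A_def)
        ultimately show ?thesis by blast
      qed (auto simp: A1_def A_def)
    qed
  qed
qed

text \<open>The balanced case \<open>a = b\<close>: without a diverse pair, \<open>V0\<close> would
  contain a homogeneous set of size \<open>a * c\<close>, which exceeds \<open>h\<close>.\<close>

lemma exists_diverse_pair:
  assumes "\<And>S. S \<subseteq> V \<Longrightarrow> card S = \<sigma> \<Longrightarrow>
      (\<exists>K\<subseteq>S. card K = c \<and> clique K E) \<and> (\<exists>I\<subseteq>S. card I = c \<and> indep I E)"
    and "\<sigma> * \<tau> \<le> 2 * w" "V0 \<subseteq> V" "8 ^ (2 * a) * w \<le> card V0"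
    and hom: "\<And>K. K \<subseteq> V \<Longrightarrow> clique K E \<or> indep K E \<Longrightarrow> card K \<le> h" and "h < a * c"
  shows "\<exists>X A. X \<subseteq> V0 \<and> A \<subseteq> V0 \<and> X \<inter> A = {} \<and> w \<le> card X \<and> w \<le> card A \<and>
    (\<forall>x\<in>X. card {x' \<in> X. card (A \<inter> sym_diff (nbrs x) (nbrs x')) < \<tau>} \<le> \<sigma>)"
proof (rule ccontr)
  assume none: "\<not> ?thesis"
  have "(\<exists>K\<subseteq>V0. card K = a * c \<and> clique K E) \<or> (\<exists>I\<subseteq>V0. card I = a * c \<and> indep I E)"
  proof (rule clique_or_indep_of_no_diverse_pair[of \<sigma> c \<tau> w V0 V0 a a])
    show "\<exists>x\<in>X. \<sigma> < card {x' \<in> X. card (A \<inter> sym_diff (nbrs x) (nbrs x')) < \<tau>}"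
      if "X \<subseteq> V0" "A \<subseteq> V0" "X \<inter> A = {}" "w \<le> card X" "w \<le> card A" for X A
      using none that by (meson not_le)
  qed (use assms in \<open>auto simp: mult_2\<close>)
  then show False using hom \<open>h < a * c\<close> \<open>V0 \<subseteq> V\<close> by (metis not_le order.trans)
qed

section \<open>A chain of vertices of large degree\<close>

text \<open>A maximal independent subset \<open>I\<close> of \<open>W\<close> dominates
  \<open>W\<close>, so small degrees would give
  \<open>card W \<le> card I * d \<le> h * d\<close>.\<close>

lemma exists_large_degree:
  assumes "W \<subseteq> V" "h * d < card W"
    and hom: "\<And>I. I \<subseteq> V \<Longrightarrow> indep I E \<Longrightarrow> card I \<le> h"
  shows "\<exists>v\<in>W. d \<le> card (W \<inter> nbrs v)"
proof (rule ccontr)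
  assume "\<not> ?thesis"
  then have small: "card (W \<inter> nbrs v) < d" if "v \<in> W" for v using that by auto
  have finW: "finite W" using assms by (intro finite_subset_verts)
  have "finite {I. I \<subseteq> W \<and> indep I E}" using finW by auto
  moreover have "{} \<in> {I. I \<subseteq> W \<and> indep I E}" by (auto simp: indep_def)
  ultimately obtain I where I: "I \<subseteq> W" "indep I E"
    and max: "\<And>J. J \<subseteq> W \<Longrightarrow> indep J E \<Longrightarrow> I \<subseteq> J \<Longrightarrow> J = I"
    using finite_has_maximal2[of "{I. I \<subseteq> W \<and> indep I E}" "{}"] by (metis (no_types, lifting) mem_Collect_eq)
  have "W \<subseteq> (\<Union>v\<in>I. insert v (W \<inter> nbrs v))"
  proof
    fix w assume w: "w \<in> W"
    show "w \<in> (\<Union>v\<in>I. insert v (W \<inter> nbrs v))"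
    proof (cases "w \<in> I")
      case False
      then have "\<not> indep (insert w I) E" using max[of "insert w I"] w I by auto
      then obtain v where "v \<in> I" "{v, w} \<in> E"
        using I(2) unfolding indep_def by (metis insert_commute insert_iff)
      then show ?thesis using w by (auto simp: nbrs_def)
    qed auto
  qed
  moreover have finI: "finite I" using I finW finite_subset by blast
  ultimately have "card W \<le> card (\<Union>v\<in>I. insert v (W \<inter> nbrs v))"
    using finW by (intro card_mono) auto
  also have "\<dots> \<le> (\<Sum>v\<in>I. card (insert v (W \<inter> nbrs v)))" using finI by (rule card_UN_le)
  \<comment> \<open>The strict inequality for the degree leaves room for \<open>v\<close>
    itself.\<close>
  also have "\<dots> \<le> (\<Sum>v\<in>I. d)"
  proof (rule sum_mono)
    fix v assume "v \<in> I"
    then have "card (W \<inter> nbrs v) < d" using small I by auto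
    then show "card (insert v (W \<inter> nbrs v)) \<le> d"
      using card_insert_le_m1[of d "W \<inter> nbrs v" v] finW by (simp add: card_insert_if)
  qed
  also have "\<dots> \<le> h * d" using hom[of I] I assms(1) by simp
  finally show False using assms(2) by simp
qed

text \<open>Vertices of large degree are peeled off \<open>T\<close> one at a time, and the
  remaining sets are read in reverse order. At least \<open>w\<close> vertices always remain, so
  \<open>deg\<close> applies throughout.\<close>

lemma exists_chain_of_large_degrees:
  assumes "T \<subseteq> V" "K + w \<le> card T" "0 < w"
    and deg: "\<And>W. W \<subseteq> T \<Longrightarrow> w \<le> card W \<Longrightarrow> \<exists>v\<in>W. d \<le> card (W \<inter> nbrs v) "
  shows "\<exists>Q :: nat \<Rightarrow> 'a set. (\<forall>k\<le>K. Q k \<subseteq> T) \<and>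
    (\<forall>k<K. \<exists>v. v \<notin> Q k \<and> Q (Suc k) = insert v (Q k) \<and> d \<le> card (Q k \<inter> nbrs v))"
proof -
  \<comment> \<open>The added condition \<open>Q K = T\<close> lets the induction append
    \<open>T\<close> to the chain obtained for \<open>T - {v}\<close>.\<close>
  have "\<exists>Q :: nat \<Rightarrow> 'a set. Q K = T \<and> (\<forall>k\<le>K. Q k \<subseteq> T) \<and>
    (\<forall>k<K. \<exists>v. v \<notin> Q k \<and> Q (Suc k) = insert v (Q k) \<and> d \<le> card (Q k \<inter> nbrs v))"
    using assms
  proof (induction K arbitrary: T)
    case 0
    then show ?case by (intro exI[of _ "\<lambda>_. T"]) auto
  next
    case (Suc K)
    have finT: "finite T" using Suc.prems by (intro finite_subset_verts)
    obtain v where v: "v \<in> T" "d \<le> card (T \<inter> nbrs v)" using Suc.prems(4)[of T] Suc.prems(2) by (meson add_leD2 order_refl)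
    have "\<exists>Q. Q K = T - {v} \<and> (\<forall>k\<le>K. Q k \<subseteq> T - {v}) \<and>
        (\<forall>k<K. \<exists>v. v \<notin> Q k \<and> Q (Suc k) = insert v (Q k) \<and> d \<le> card (Q k \<inter> nbrs v))"
    proof (rule Suc.IH)
      show "K + w \<le> card (T - {v})" using Suc.prems v finT by simp
      show "\<exists>u\<in>W. d \<le> card (W \<inter> nbrs u)" if "W \<subseteq> T - {v}" "w \<le> card W" for W
        using Suc.prems(4)[of W] that by blast
    qed (use Suc.prems in auto)
    then obtain Q where Q: "Q K = T - {v}" "\<forall>k\<le>K. Q k \<subseteq> T - {v}"
        "\<forall>k<K. \<exists>v. v \<notin> Q k \<and> Q (Suc k) = insert v (Q k) \<and> d \<le> card (Q k \<inter> nbrs v)" by blast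
    have "(T - {v}) \<inter> nbrs v = T \<inter> nbrs v" using edge_distinct[of v v] by (auto simp: nbrs_def)
    then have "v \<notin> Q K \<and> T = insert v (Q K) \<and> d \<le> card (Q K \<inter> nbrs v)"
      using v Q by auto
    then show ?case using Q
      by (intro exI[of _ "Q(Suc K := T)"]) (auto simp: le_Suc_eq less_Suc_eq)
  qed
  then show ?thesis by blast
qed

section \<open>Many edge counts\<close>

text \<open>Telescoping: each step adds one vertex, so a degree grows by at most 1 while the edge
  count grows by at least \<open>d\<close>. Vertices of \<open>Z\<close>, lying outside
  \<open>T\<close>, can only add further edges.\<close>

lemma chain_mono:
  fixes Q :: "nat \<Rightarrow> 'a set"
  assumes "\<And>k. k < K \<Longrightarrow> \<exists>v. v \<notin> Q k \<and> Q (Suc k) = insert v (Q k) \<and> d \<le> card (Q k \<inter> nbrs v)"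
    and "\<And>k. k \<le> K \<Longrightarrow> Q k \<subseteq> T" and "T \<subseteq> V" and "k \<le> k'" "k' \<le> K"
  shows "Q k \<subseteq> Q k'" and "card (Q k' \<inter> nbrs v) \<le> card (Q k \<inter> nbrs v) + (k' - k)"
    and "finite Z \<Longrightarrow> Z \<inter> T = {} \<Longrightarrow> num_edges (Q k \<union> Z) + (k' - k) * d \<le> num_edges (Q k' \<union> Z)"
proof -
  have "Q k \<subseteq> Q k' \<and> card (Q k' \<inter> nbrs v) \<le> card (Q k \<inter> nbrs v) + (k' - k) \<and>
    (finite Z \<and> Z \<inter> T = {} \<longrightarrow> num_edges (Q k \<union> Z) + (k' - k) * d \<le> num_edges (Q k' \<union> Z))"
    using assms(4,5)
  proof (induction k' rule: dec_induct)
    case (step m)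
    then obtain u where u: "u \<notin> Q m" "Q (Suc m) = insert u (Q m)" "d \<le> card (Q m \<inter> nbrs u)"
      using assms(1)[of m] by auto
    have fin: "finite (Q m)"
      using assms(2)[of m] assms(3) step by (intro finite_subset_verts) auto
    have IH: "Q k \<subseteq> Q m" "card (Q m \<inter> nbrs v) \<le> card (Q k \<inter> nbrs v) + (m - k)"
        "finite Z \<Longrightarrow> Z \<inter> T = {} \<Longrightarrow> num_edges (Q k \<union> Z) + (m - k) * d \<le> num_edges (Q m \<union> Z)"
      using step by auto
    have "card (Q (Suc m) \<inter> nbrs v) \<le> card (insert u (Q m \<inter> nbrs v))"
      using u fin by (intro card_mono) auto
    also have "\<dots> \<le> Suc (card (Q m \<inter> nbrs v))" using fin by (simp add: card_insert_if)
    finally have 1: "card (Q (Suc m) \<inter> nbrs v) \<le> card (Q k \<inter> nbrs v) + (Suc m - k)"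
      using IH(2) step by simp
    have 2: "num_edges (Q k \<union> Z) + (Suc m - k) * d \<le> num_edges (Q (Suc m) \<union> Z)"
      if Z: "finite Z" "Z \<inter> T = {}"
    proof -
      have "u \<in> T" using u(2) assms(2)[of "Suc m"] step by auto
      then have "u \<notin> Q m \<union> Z" using u Z by auto
      then have "num_edges (Q (Suc m) \<union> Z) = num_edges (Q m \<union> Z) + card ((Q m \<union> Z) \<inter> nbrs u)"
        using num_edges_insert[of u "Q m \<union> Z"] u by simp
      moreover have "card (Q m \<inter> nbrs u) \<le> card ((Q m \<union> Z) \<inter> nbrs u)"
        using fin Z by (intro card_mono) auto
      moreover have "(Suc m - k) * d = (m - k) * d + d"
        using step by (simp add: Suc_diff_le)
      ultimately show ?thesis using IH(3)[OF Z] u(3) by linarith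
    qed
    show ?case using IH(1) u(2) 1 2 by auto
  qed auto
  then show "Q k \<subseteq> Q k'" and "card (Q k' \<inter> nbrs v) \<le> card (Q k \<inter> nbrs v) + (k' - k)"
    and "finite Z \<Longrightarrow> Z \<inter> T = {} \<Longrightarrow> num_edges (Q k \<union> Z) + (k' - k) * d \<le> num_edges (Q k' \<union> Z)"
    by auto
qed

lemma card_Un_inter_nbrs:
  assumes "finite A" "finite B" "A \<inter> B = {}"
  shows "card ((A \<union> B) \<inter> nbrs v) = card (A \<inter> nbrs v) + card (B \<inter> nbrs v)"
  using assms by (subst card_Un_disjoint[symmetric]) (auto intro!: arg_cong[where f = card])

text \<open>
  The triple \<open>(p, q, j)\<close> consists of the digits of a mixed radix system: increasing \<open>p\<close> or \<open>q\<close> adds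
  vertices of \<open>T\<close>, increasing \<open>j\<close> swaps \<open>b p j\<close> for \<open>a p j\<close>, and each digit outweighs the
  fluctuations of the later ones and of the degree of the last vertex \<open>x\<close>.
\<close>

lemma sum_card_values_le_card_induced_sizes:
  fixes Q :: "nat \<Rightarrow> 'a set" and a b :: "nat \<Rightarrow> nat \<Rightarrow> 'a" and Xp :: "nat \<Rightarrow> 'a set"
    and M :: nat
  defines "S \<equiv> \<lambda>p j. a p ` {..<j} \<union> b p ` {j..<M}"
  assumes chain: "\<And>k. k < K \<Longrightarrow> \<exists>v. v \<notin> Q k \<and> Q (Suc k) = insert v (Q k) \<and> d \<le> card (Q k \<inter> nbrs v)"
      "\<And>k. k \<le> K \<Longrightarrow> Q k \<subseteq> T"
    and sub: "T \<subseteq> V" "U \<subseteq> V" "C \<subseteq> V" "X \<subseteq> V"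
    and disj: "U \<inter> T = {}" "C \<inter> T = {}" "X \<inter> T = {}" "C \<inter> U = {}" "X \<inter> U = {}" "X \<inter> C = {}"
    and n: "card (T \<union> U \<union> C \<union> X) \<le> n"
    and I: "\<And>p q j. (p, q, j) \<in> I \<Longrightarrow> p \<in> G \<and> q < L \<and> j < M"
    and finI: "finite I"
    and G: "\<And>p. p \<in> G \<Longrightarrow> p < P"
    and pairs: "\<And>p. p \<in> G \<Longrightarrow> inj_on (a p) {..<M} \<and> inj_on (b p) {..<M} \<and>
      a p ` {..<M} \<inter> b p ` {..<M} = {}"
      "\<And>p j. p \<in> G \<Longrightarrow> j < M \<Longrightarrow> a p j \<in> C \<and> b p j \<in> C \<and>
        card ((Q (J * p) \<union> U) \<inter> nbrs (b p j)) + r \<le> card ((Q (J * p) \<union> U) \<inter> nbrs (a p j)) \<and>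
        card ((Q (J * p) \<union> U) \<inter> nbrs (a p j)) \<le> card ((Q (J * p) \<union> U) \<inter> nbrs (b p j)) + W"
    and Xp: "\<And>p. p \<in> G \<Longrightarrow> Xp p \<subseteq> X"
      "\<And>p x x'. p \<in> G \<Longrightarrow> x \<in> Xp p \<Longrightarrow> x' \<in> Xp p \<Longrightarrow>
        card ((Q (J * p) \<union> U) \<inter> nbrs x) \<le> card ((Q (J * p) \<union> U) \<inter> nbrs x') + \<omega>"
    and num: "L \<le> J" "J * P \<le> K" "\<omega> + 2 * L + 2 * M < r"
      "M * (W + L + M) + \<omega> + L + M < d" "(M + 1) * n < (J - L) * d"
  shows "(\<Sum>(p, q, j)\<in>I. card ((\<lambda>x. card ((Q (J * p + q) \<union> U \<union> S p j) \<inter> nbrs x)) ` Xp p))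
    \<le> card (\<Phi> V E)"
proof -
  note ch = chain_mono[where Q = Q and K = K and d = d and T = T, OF chain sub(1)]
  have fin: "finite T" "finite U" "finite C" "finite X"
    using sub by (auto intro: finite_subset_verts)
  have idx: "J * p + q \<le> K" if "p \<in> G" "q \<le> L" for p q
  proof -
    have "J * p + q \<le> J * Suc p" using that num by simp
    also have "\<dots> \<le> J * P" using G[OF that(1)] by (intro mult_le_mono) auto
    finally show ?thesis using num by linarith
  qed
  have QT: "Q (J * p + q) \<subseteq> T" if "p \<in> G" "q \<le> L" for p q
    using chain(2) idx[OF that] by auto
  have SC: "S p j \<subseteq> C" if "p \<in> G" "j \<le> M" for p j
    using that pairs(2)[of p] by (auto simp: S_def)
  have cS: "card (S p j) \<le> M" if "p \<in> G" "j \<le> M" for p j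
  proof -
    have "card (S p j) \<le> card (a p ` {..<j}) + card (b p ` {j..<M})"
      by (simp add: S_def card_Un_le)
    also have "\<dots> \<le> j + (M - j)"
      using card_image_le[of "{..<j}" "a p"] card_image_le[of "{j..<M}" "b p"] by simp
    finally show ?thesis using that by simp
  qed
  define B where "B p q j = Q (J * p + q) \<union> U \<union> S p j" for p q j
  define e where "e p q j = num_edges (B p q j)" for p q j
  define g where "g p q j x = card (B p q j \<inter> nbrs x)" for p q j x
  define D where "D p x = card ((Q (J * p) \<union> U) \<inter> nbrs x)" for p x
  have finQ: "finite (Q (J * p + q))" if "p \<in> G" "q \<le> L" for p q
    using QT[OF that] fin(1) finite_subset by blast
  \<comment> \<open>Up to an error \<open>L\<close>, the degree at the start \<open>J * p\<close> of
    a block is valid for all \<open>q \<le> L\<close>. This is why the pairs and the sets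
    \<open>Xp\<close> may depend on \<open>p\<close> only.\<close>
  have degree: "D p x + card (Z \<inter> nbrs x) \<le> card ((Q (J * p + q) \<union> U \<union> Z) \<inter> nbrs x) \<and>
      card ((Q (J * p + q) \<union> U \<union> Z) \<inter> nbrs x) \<le> D p x + L + card (Z \<inter> nbrs x)"
    if pq: "p \<in> G" "q \<le> L" and Z: "Z \<subseteq> C" for p q Z x
  proof -
    have finZ: "finite Z" using Z fin finite_subset by blast
    have "card ((Q (J * p + q) \<union> U \<union> Z) \<inter> nbrs x)
        = card (Q (J * p + q) \<inter> nbrs x) + card (U \<inter> nbrs x) + card (Z \<inter> nbrs x)"
      using finQ[OF pq] QT[OF pq] fin finZ disj Z by (subst card_Un_inter_nbrs, auto)+
    moreover have "D p x = card (Q (J * p) \<inter> nbrs x) + card (U \<inter> nbrs x)"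
      unfolding D_def using finQ[of p 0] QT[of p 0] pq fin disj
      by (subst card_Un_inter_nbrs) auto
    moreover have "card (Q (J * p) \<inter> nbrs x) \<le> card (Q (J * p + q) \<inter> nbrs x)"
      using ch(1)[of "J * p" "J * p + q"] idx[OF pq] finQ[OF pq] by (intro card_mono) auto
    moreover have "card (Q (J * p + q) \<inter> nbrs x) \<le> card (Q (J * p) \<inter> nbrs x) + L"
      using ch(2)[of "J * p" "J * p + q" x] idx[OF pq] pq by simp
    ultimately show ?thesis by linarith
  qed
  \<comment> \<open>Consecutive swap sets share \<open>Z\<close> and exchange \<open>b p j\<close>
    for \<open>a p j\<close>, so the step is the difference of these two degrees, which lies between
    \<open>r\<close> and \<open>W\<close> up to errors \<open>L + M\<close>.\<close>
  have stepj: "e p q j + r \<le> e p q (Suc j) + L + M \<and> e p q (Suc j) \<le> e p q j + (W + L + M)"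
    if pqj: "p \<in> G" "q \<le> L" "j < M" for p q j
  proof -
    define Z where "Z = a p ` {..<j} \<union> b p ` {Suc j..<M}"
    have ZC: "Z \<subseteq> C" using pqj pairs(2)[of p] by (auto simp: Z_def)
    have S1: "S p (Suc j) = insert (a p j) Z" by (auto simp: S_def Z_def lessThan_Suc)
    have "{j..<M} = insert j {Suc j..<M}" using pqj by auto
    then have S2: "S p j = insert (b p j) Z" by (auto simp: S_def Z_def)
    have aC: "a p j \<in> C" "b p j \<in> C" using pairs(2)[of p j] pqj by auto
    have inj: "inj_on (a p) {..<M}" "inj_on (b p) {..<M}" "a p ` {..<M} \<inter> b p ` {..<M} = {}"
      using pairs(1)[of p] pqj by auto
    have "a p j \<notin> a p ` {..<j}" using inj(1) pqj by (auto dest: inj_onD)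
    moreover have "a p j \<notin> b p ` {Suc j..<M}" using inj(3) pqj by fastforce
    ultimately have aZ: "a p j \<notin> Z" by (simp add: Z_def)
    have "b p j \<notin> b p ` {Suc j..<M}" using inj(2) pqj by (auto dest: inj_onD)
    moreover have "b p j \<notin> a p ` {..<j}" using inj(3) pqj by fastforce
    ultimately have bZ: "b p j \<notin> Z" by (simp add: Z_def)
    let ?R = "Q (J * p + q) \<union> U \<union> Z"
    have CR: "C \<inter> ?R \<subseteq> Z" using QT[of p q] pqj disj by auto
    have e1: "e p q (Suc j) = num_edges ?R + card (?R \<inter> nbrs (a p j))"
      using num_edges_insert[of "a p j" ?R] aZ aC CR by (auto simp: e_def B_def S1)
    have e2: "e p q j = num_edges ?R + card (?R \<inter> nbrs (b p j))"
      using num_edges_insert[of "b p j" ?R] bZ aC CR by (auto simp: e_def B_def S2)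
    have finZ: "finite Z" using ZC fin finite_subset by blast
    have "card Z \<le> card (S p j)" using S2 finZ by (auto intro: card_mono)
    then have cZ: "card Z \<le> M" using cS[of p j] pqj by simp
    have ZM: "card (Z \<inter> nbrs x) \<le> M" for x
      using card_inter_nbrs_le[OF finZ, of x] cZ by linarith
    have Dab: "D p (b p j) + r \<le> D p (a p j)" "D p (a p j) \<le> D p (b p j) + W"
      using pairs(2)[of p j] pqj by (auto simp: D_def)
    note da = degree[OF pqj(1,2) ZC, of "a p j", THEN conjunct1]
      degree[OF pqj(1,2) ZC, of "a p j", THEN conjunct2]
    note db = degree[OF pqj(1,2) ZC, of "b p j", THEN conjunct1]
      degree[OF pqj(1,2) ZC, of "b p j", THEN conjunct2]
    show ?thesis unfolding e1 e2
      using ZM[of "a p j"] ZM[of "b p j"] Dab da db by (intro conjI) linarith+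
  qed
  have rLM: "L + M < r" using num by linarith
  \<comment> \<open>A single gap is retained; the further swaps only have to increase the count, by
    \<open>L + M < r\<close>.\<close>
  have lessj: "e p q j + r \<le> e p q j' + L + M" if pq: "p \<in> G" "q \<le> L" and j: "j < j'" "j' \<le> M"
    for p q j j'
  proof -
    have "Suc j \<le> j'" using j by simp
    then show ?thesis using j(2)
    proof (induction j' rule: dec_induct)
      case base
      then show ?case using stepj[OF pq, of j] by simp
    next
      case (step m)
      then show ?case using stepj[OF pq, of m] rLM by simp
    qed
  qed
  have upj: "e p q j \<le> e p q 0 + M * (W + L + M)" if pq: "p \<in> G" "q \<le> L" and j: "j \<le> M" for p q j
  proof -
    have "e p q j \<le> e p q 0 + j * (W + L + M)" using j
    proof (induction j)
      case (Suc j)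
      then show ?case using stepj[OF pq, of j] by simp
    qed simp
    also have "\<dots> \<le> e p q 0 + M * (W + L + M)"
      using j by (intro add_left_mono mult_le_mono1)
    finally show ?thesis .
  qed
  \<comment> \<open>Bounds the fluctuation of the degree of the last vertex within one block
    \<open>p\<close>.\<close>
  have gg: "g p q j x \<le> g p q' j' x' + \<omega> + L + M"
    if "p \<in> G" "q \<le> L" "q' \<le> L" "j \<le> M" "j' \<le> M" "x \<in> Xp p" "x' \<in> Xp p" for p q q' j j' x x'
  proof -
    have "finite (S p j)" using SC[of p j] that fin finite_subset by blast
    then have "card (S p j \<inter> nbrs x) \<le> M"
      using card_inter_nbrs_le[of "S p j" x] cS[of p j] that by simp
    moreover have "D p x \<le> D p x' + \<omega>" using Xp(2)[of p x x'] that by (simp add: D_def)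
    moreover note degree[OF that(1,2) SC[OF that(1,4)], of x, THEN conjunct2]
      degree[OF that(1,3) SC[OF that(1,5)], of x', THEN conjunct1]
    ultimately show ?thesis unfolding g_def B_def by linarith
  qed
  have BV: "B p q j \<subseteq> T \<union> U \<union> C" if "p \<in> G" "q \<le> L" "j \<le> M" for p q j
    using QT[of p q] SC[of p j] that by (auto simp: B_def)
  have cn: "card W \<le> n" if "W \<subseteq> T \<union> U \<union> C" for W
  proof -
    have "card W \<le> card (T \<union> U \<union> C \<union> X)" using that fin by (intro card_mono) auto
    then show ?thesis using n by linarith
  qed
  \<comment> \<open>Lexicographically larger digits give larger edge counts. The first digit that
    differs selects the case, and the last three conditions of \<open>num\<close> are the
    comparisons for \<open>j\<close>, \<open>q\<close> and \<open>p\<close>.\<close>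
  have sep: "e p q j + g p q j x < e p' q' j' + g p' q' j' x'"
    if i: "p \<in> G" "q < L" "j < M" "p' \<in> G" "q' < L" "j' < M"
      and lt: "p < p' \<or> p = p' \<and> (q < q' \<or> q = q' \<and> j < j')"
      and x: "x \<in> Xp p" "x' \<in> Xp p'" for p q j p' q' j' x x'
    using lt
  proof (elim disjE conjE)
    assume "p = p'" "q = q'" "j < j'"
    moreover from this have "e p q j + r \<le> e p q j' + L + M" using i by (intro lessj) auto
    moreover from calculation have "g p q j x \<le> g p q j' x' + \<omega> + L + M"
      using i x by (intro gg) auto
    ultimately show ?thesis using num(3) by simp
  next
    assume eq: "p = p'" and q: "q < q'"
    have "e p q j \<le> e p q 0 + M * (W + L + M)" using i by (intro upj) auto
    moreover have "e p q 0 + d \<le> e p q' 0"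
    proof -
      have "num_edges (Q (J * p + q) \<union> (U \<union> S p 0)) + (J * p + q' - (J * p + q)) * d
          \<le> num_edges (Q (J * p + q') \<union> (U \<union> S p 0))"
        using i eq q idx[of p q'] SC[of p 0] fin disj
        by (intro ch(3)) (auto intro: finite_subset)
      moreover have "1 * d \<le> (J * p + q' - (J * p + q)) * d" using q by (intro mult_le_mono1) simp
      ultimately show ?thesis unfolding e_def B_def Un_assoc by linarith
    qed
    moreover have "e p q' 0 \<le> e p q' j'"
    proof (cases "j' = 0")
      case False
      then show ?thesis using lessj[of p q' 0 j'] i eq rLM by simp
    qed simp
    moreover have "g p q j x \<le> g p q' j' x' + \<omega> + L + M" using i x eq by (intro gg) auto
    ultimately show ?thesis using num(4) eq by simp
  next
    \<comment> \<open>Swap sets for different \<open>p\<close> are unrelated, so the edges at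
      \<open>S p j\<close> are bounded crudely by \<open>M * n\<close>. Since \<open>q < L\<close>,
      the two positions are at least \<open>J - L\<close> chain steps apart.\<close>
    assume p: "p < p'"
    let ?k = "J * p + q" and ?k' = "J * p' + q'"
    have "e p q j \<le> num_edges (Q ?k \<union> U) + card (S p j) * n"
      unfolding e_def B_def using i fin finQ[of p q] SC[of p j] BV[of p q j]
      by (intro num_edges_Un_le cn) (auto intro: finite_subset simp: B_def)
    also have "\<dots> \<le> num_edges (Q ?k \<union> U) + M * n"
      using cS[of p j] i by simp
    finally have "e p q j \<le> num_edges (Q ?k \<union> U) + M * n" .
    moreover have "g p q j x \<le> n"
    proof -
      have "B p q j \<inter> nbrs x \<subseteq> T \<union> U \<union> C" using BV[of p q j] i by auto
      then show ?thesis unfolding g_def by (rule cn)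
    qed
    moreover have "J * p + J \<le> J * p'"
      using p by (metis Suc_leI mult_Suc_right mult_le_mono2 add.commute)
    then have kk: "?k \<le> ?k'" "J - L \<le> ?k' - ?k" using i num(1) by auto
    then have "num_edges (Q ?k \<union> U) + (?k' - ?k) * d \<le> num_edges (Q ?k' \<union> U)"
      using i fin disj idx[of p' q'] by (intro ch(3)) auto
    moreover have "(J - L) * d \<le> (?k' - ?k) * d" using kk by (intro mult_le_mono1)
    moreover have "num_edges (Q ?k' \<union> U) \<le> e p' q' j'"
      unfolding e_def B_def by (intro num_edges_mono) auto
    ultimately show ?thesis using num(5) by (simp add: algebra_simps)
  qed
  define Y where "Y = (\<lambda>(p, q, j). (\<lambda>x. e p q j + g p q j x) ` Xp p)"
  have "(\<Sum>(p, q, j)\<in>I. card ((\<lambda>x. card ((Q (J * p + q) \<union> U \<union> S p j) \<inter> nbrs x)) ` Xp p))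
      = (\<Sum>i\<in>I. card (Y i))"
  proof (rule sum.cong[OF refl], clarify)
    fix p q j
    have "Y (p, q, j) = (+) (e p q j) ` g p q j ` Xp p" by (auto simp: Y_def)
    then have "card (Y (p, q, j)) = card (g p q j ` Xp p)" by (simp add: card_image)
    then show "card ((\<lambda>x. card ((Q (J * p + q) \<union> U \<union> S p j) \<inter> nbrs x)) ` Xp p) = card (Y (p, q, j))"
      by (simp add: g_def[abs_def] B_def)
  qed
  also have "\<dots> = card (\<Union>i\<in>I. Y i)"
  proof (rule card_UN_disjoint[symmetric, OF finI])
    have "finite (Xp p)" if "p \<in> G" for p using Xp(1)[OF that] fin finite_subset by blast
    then show "\<forall>i\<in>I. finite (Y i)" using I by (fastforce simp: Y_def)
    show "\<forall>i\<in>I. \<forall>i'\<in>I. i \<noteq> i' \<longrightarrow> Y i \<inter> Y i' = {}"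
    proof (intro ballI impI)
      fix i i' assume ii: "i \<in> I" "i' \<in> I" "i \<noteq> i'"
      obtain p q j p' q' j' where eq: "i = (p, q, j)" "i' = (p', q', j')" by (metis prod_cases3)
      have lt: "p < p' \<or> p = p' \<and> (q < q' \<or> q = q' \<and> j < j') \<or>
          p' < p \<or> p' = p \<and> (q' < q \<or> q' = q \<and> j' < j)" using ii eq by auto
      have r: "p \<in> G" "q < L" "j < M" "p' \<in> G" "q' < L" "j' < M" using I ii eq by auto
      have "v \<noteq> w" if vw: "v \<in> Y i" "w \<in> Y i'" for v w
      proof -
        obtain x x' where x: "x \<in> Xp p" "x' \<in> Xp p'"
          and v: "v = e p q j + g p q j x" "w = e p' q' j' + g p' q' j' x'"
          using vw eq by (auto simp: Y_def)
        then show ?thesis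
          using lt sep[OF r _ x] sep[OF r(4-6) r(1-3) _ x(2,1)] by auto
      qed
      then show "Y i \<inter> Y i' = {}" by blast
    qed
  qed
  also have "\<dots> \<le> card (\<Phi> V E)"
  proof (rule card_mono[OF finite_induced_sizes], rule subsetI)
    fix v assume "v \<in> (\<Union>i\<in>I. Y i)"
    then obtain p q j where i: "(p, q, j) \<in> I" "v \<in> Y (p, q, j)" by auto
    then obtain x where x: "x \<in> Xp p" "v = e p q j + g p q j x" by (auto simp: Y_def)
    have pqj: "p \<in> G" "q \<le> L" "j \<le> M" using I[OF i(1)] by auto
    have "x \<in> X" using x Xp(1)[OF pqj(1)] by auto
    then have "x \<notin> B p q j" using BV[OF pqj] disj by auto
    then have "v = num_edges (insert x (B p q j))"
      using x by (simp add: num_edges_insert e_def g_def)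
    moreover have "insert x (B p q j) \<subseteq> V" using BV[OF pqj] \<open>x \<in> X\<close> sub by auto
    ultimately show "v \<in> \<Phi> V E" using num_edges_in_induced_sizes by simp
  qed
  finally show ?thesis .
qed

text \<open>The order of the choices matters: windows in \<open>C\<close>, then \<open>U2\<close>,
  the swap pairs, windows in \<open>X\<close>, and \<open>U1\<close> last. The factor
  \<open>32 * \<sigma>\<close> combines two halvings of the index sets with the loss
  \<open>8 * \<sigma>\<close> in the number of values.\<close>

lemma card_induced_sizes_ge:
  fixes Q :: "nat \<Rightarrow> 'a set" and \<delta>1 \<delta>2 :: nat
  assumes chain: "\<And>k. k < K \<Longrightarrow> \<exists>v. v \<notin> Q k \<and> Q (Suc k) = insert v (Q k) \<and> d \<le> card (Q k \<inter> nbrs v)"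
      "\<And>k. k \<le> K \<Longrightarrow> Q k \<subseteq> T"
    and sub: "T \<subseteq> V" "A1 \<subseteq> V" "A2 \<subseteq> V" "C \<subseteq> V" "X \<subseteq> V"
    and disj: "A1 \<inter> T = {}" "A2 \<inter> T = {}" "C \<inter> T = {}" "X \<inter> T = {}" "A1 \<inter> A2 = {}"
      "C \<inter> A1 = {}" "C \<inter> A2 = {}" "X \<inter> A1 = {}" "X \<inter> A2 = {}" "X \<inter> C = {}"
    and n: "card (T \<union> A1 \<union> A2 \<union> C \<union> X) \<le> n"
    and pos: "0 < \<sigma>" "0 < t1" "0 < t2"
    and twins1: "\<And>x. x \<in> X \<Longrightarrow>
      card {x' \<in> X. card (A1 \<inter> sym_diff (nbrs x) (nbrs x')) < t1\<^sup>2} \<le> \<sigma>"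
    and twins2: "\<And>x. x \<in> C \<Longrightarrow>
      card {x' \<in> C. card (A2 \<inter> sym_diff (nbrs x) (nbrs x')) < t2\<^sup>2} \<le> \<sigma>"
    and win1: "0 < b1" "2 * n < b1 * w1" "z1 * b1 \<le> card X" "0 < z1" "z1 \<le> \<sigma> * t1"
    and win2: "0 < b2" "2 * n < b2 * w2" "z2 * b2 \<le> card C" "0 < z2" "z2 \<le> \<sigma> * t2"
      "8 * \<sigma> * (2 * M + R) \<le> z2"
    and dev1: "0 < \<delta>1" "\<delta>1 \<le> card A1" "4 * real n * exp (- ((real \<delta>1)\<^sup>2 / (4 * real (card A1)))) \<le> 1"
    and dev2: "0 < \<delta>2" "\<delta>2 \<le> card A2" "4 * real n * exp (- ((real \<delta>2)\<^sup>2 / (4 * real (card A2)))) \<le> 1"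
    and num: "L \<le> J" "J * P \<le> K" "2 * (w1 + 2 * \<delta>1 + 2 * L + 2 * M + 1) + 2 * \<delta>1 \<le> R"
      "M * (w2 + 2 * \<delta>2 + 2 * \<delta>1 + L + M) + w1 + 2 * \<delta>1 + L + M < d"
      "(M + 1) * n < (J - L) * d"
  shows "P * L * M * z1 \<le> 32 * \<sigma> * card (\<Phi> V E)"
proof -
  have fin: "finite T" "finite A1" "finite A2" "finite C" "finite X"
    using sub by (auto intro: finite_subset_verts)
  have idx: "J * p + q \<le> K" if "p < P" "q \<le> L" for p q
  proof -
    have "J * p + q \<le> J * Suc p" using that num by simp
    also have "\<dots> \<le> J * P" using that by (intro mult_le_mono) auto
    finally show ?thesis using num by linarith
  qed
  have QT: "Q (J * p + q) \<subseteq> T" if "p < P" "q \<le> L" for p q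
    using chain(2) idx[OF that] by auto
  have finQ: "finite (Q (J * p + q))" if "p < P" "q \<le> L" for p q
    using QT[OF that] fin(1) finite_subset by blast
  have cTA: "card (T \<inter> nbrs v) + card (A2 \<inter> nbrs v) + card (A1 \<inter> nbrs v) \<le> n" for v
  proof -
    have "card (T \<inter> nbrs v) + card (A2 \<inter> nbrs v) + card (A1 \<inter> nbrs v)
        = card ((T \<union> A2 \<union> A1) \<inter> nbrs v)"
      using fin disj by (subst card_Un_inter_nbrs, auto)+
    also have "\<dots> \<le> card (T \<union> A1 \<union> A2 \<union> C \<union> X)" using fin by (intro card_mono) auto
    finally show ?thesis using n by linarith
  qed
  have cQ: "card (Q (J * p) \<inter> nbrs v) \<le> card (T \<inter> nbrs v)" if "p < P" for p v
    using QT[OF that, of 0] fin by (intro card_mono) auto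
  have cCX: "card (C \<union> X) \<le> n"
  proof -
    have "card (C \<union> X) \<le> card (T \<union> A1 \<union> A2 \<union> C \<union> X)" using fin by (intro card_mono) auto
    then show ?thesis using n by linarith
  qed
  \<comment> \<open>Twice the expected degree into the base set together with both random sets.
    Doubling keeps it an integer, and it is at most \<open>2 * n\<close>.\<close>
  define H2 where "H2 p c = 2 * card (Q (J * p) \<inter> nbrs c) + card (A2 \<inter> nbrs c) + card (A1 \<inter> nbrs c)"
    for p c
  have "\<exists>Z. p < P \<longrightarrow> Z \<subseteq> C \<and> card Z = z2 \<and> (\<forall>c\<in>Z. \<forall>c'\<in>Z. H2 p c \<le> H2 p c' + w2)" for p
  proof (cases "p < P")
    case True
    have "H2 p c < b2 * w2" for c
      using cTA[of c] cQ[OF True, of c] win2(2) unfolding H2_def by linarith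
    then show ?thesis using exists_window[of C b2 "H2 p" w2 z2] fin win2 by blast
  qed auto
  then obtain Cp where Cp: "\<And>p. p < P \<Longrightarrow> Cp p \<subseteq> C" "\<And>p. p < P \<Longrightarrow> card (Cp p) = z2"
      "\<And>p c c'. p < P \<Longrightarrow> c \<in> Cp p \<Longrightarrow> c' \<in> Cp p \<Longrightarrow> H2 p c \<le> H2 p c' + w2"
    by metis
  \<comment> \<open>\<open>U1\<close> is still represented by its expectation, so the swap pairs
    will not depend on it. The weight 2 given to \<open>U2\<close> below matches the
    doubling.\<close>
  define s2 where "s2 p c = 2 * card (Q (J * p) \<inter> nbrs c) + card (A1 \<inter> nbrs c)" for p c
  have "4 * real (card (C \<union> X)) * exp (- ((real \<delta>2)\<^sup>2 / (4 * real (card A2))))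
      \<le> 1"
    using cCX by (intro order.trans[OF _ dev2(3)] mult_right_mono) auto
  then have "\<exists>U2\<subseteq>A2. (\<forall>v\<in>C \<union> X. \<bar>2 * real (card (U2 \<inter> nbrs v)) - real (card (A2 \<inter> nbrs v))\<bar> \<le> real \<delta>2) \<and>
      card {..<P} \<le> 2 * card {p \<in> {..<P}. z2 \<le> 8 * \<sigma> * card ((\<lambda>x. s2 p x + 2 * card (U2 \<inter> nbrs x)) ` Cp p)}"
    using fin pos twins2 Cp win2 dev2
    by (intro exists_concentrated_subset_many_values[where X = C and z = z2 and t = t2]) auto
  then obtain U2 where U2: "U2 \<subseteq> A2"
      "\<And>v. v \<in> C \<union> X \<Longrightarrow> \<bar>2 * real (card (U2 \<inter> nbrs v)) - real (card (A2 \<inter> nbrs v))\<bar> \<le> real \<delta>2"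
      "P \<le> 2 * card {p \<in> {..<P}. z2 \<le> 8 * \<sigma> * card ((\<lambda>x. s2 p x + 2 * card (U2 \<inter> nbrs x)) ` Cp p)}"
    by auto
  define F2 where "F2 p x = s2 p x + 2 * card (U2 \<inter> nbrs x)" for p x
  define G where "G = {p \<in> {..<P}. z2 \<le> 8 * \<sigma> * card (F2 p ` Cp p)}"
  have G: "P \<le> 2 * card G" "finite G" "\<And>p. p \<in> G \<Longrightarrow> p < P"
    using U2(3) by (auto simp: G_def F2_def)
  have F2_window: "F2 p c \<le> F2 p c' + (w2 + 2 * \<delta>2)" if "p < P" "c \<in> Cp p" "c' \<in> Cp p" for p c c'
  proof -
    have "2 * card (U2 \<inter> nbrs c) \<le> card (A2 \<inter> nbrs c) + \<delta>2"
        "card (A2 \<inter> nbrs c') \<le> 2 * card (U2 \<inter> nbrs c') + \<delta>2"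
      using U2(2)[of c] U2(2)[of c'] Cp(1)[OF that(1)] that(2,3) by (auto simp: abs_le_iff; linarith)+
    then show ?thesis using Cp(3)[OF that] unfolding F2_def s2_def H2_def by linarith
  qed
  have "\<exists>ab. p \<in> G \<longrightarrow> inj_on (fst ab) {..<M} \<and> inj_on (snd ab) {..<M} \<and>
      fst ab ` {..<M} \<inter> snd ab ` {..<M} = {} \<and>
      (\<forall>i<M. fst ab i \<in> Cp p \<and> snd ab i \<in> Cp p \<and> F2 p (snd ab i) + R \<le> F2 p (fst ab i))"
    for p :: nat
  proof (cases "p \<in> G")
    case True
    have "8 * \<sigma> * (2 * M + R) \<le> 8 * \<sigma> * card (F2 p ` Cp p)"
      using True by (intro le_trans[OF win2(6)]) (simp add: G_def)
    then have "2 * M + R \<le> card (F2 p ` Cp p)" using pos by (simp only: mult_le_cancel1)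
    moreover have "finite (Cp p)" using Cp(1)[of p] G(3)[OF True] fin finite_subset by blast
    ultimately show ?thesis using exists_separated_pairs[of "Cp p" M R "F2 p"] by auto
  qed auto
  then obtain ab where ab: "\<And>p. p \<in> G \<Longrightarrow> inj_on (fst (ab p)) {..<M} \<and> inj_on (snd (ab p)) {..<M} \<and>
      fst (ab p) ` {..<M} \<inter> snd (ab p) ` {..<M} = {} \<and>
      (\<forall>i<M. fst (ab p) i \<in> Cp p \<and> snd (ab p) i \<in> Cp p \<and> F2 p (snd (ab p) i) + R \<le> F2 p (fst (ab p) i))"
    by metis
  define a where "a p = fst (ab p)" for p
  define b where "b p = snd (ab p)" for p
  have inj: "inj_on (a p) {..<M} \<and> inj_on (b p) {..<M} \<and> a p ` {..<M} \<inter> b p ` {..<M} = {}"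
    if "p \<in> G" for p using ab[OF that] by (simp add: a_def b_def)
  have abC: "a p i \<in> Cp p" "b p i \<in> Cp p" "F2 p (b p i) + R \<le> F2 p (a p i)"
    if "p \<in> G" "i < M" for p i
    using ab[OF that(1)] that(2) by (auto simp: a_def b_def)
  \<comment> \<open>The same quantity as \<open>F2\<close>, now used for the windows in
    \<open>X\<close>: \<open>U2\<close> is fixed and only \<open>U1\<close> is averaged.\<close>
  define H1 where "H1 p x = 2 * card (Q (J * p) \<inter> nbrs x) + 2 * card (U2 \<inter> nbrs x) + card (A1 \<inter> nbrs x)"
    for p x
  have F2_eq: "F2 = H1" by (simp add: fun_eq_iff F2_def s2_def H1_def)
  have "\<exists>Z. p < P \<longrightarrow> Z \<subseteq> X \<and> card Z = z1 \<and> (\<forall>c\<in>Z. \<forall>c'\<in>Z. H1 p c \<le> H1 p c' + w1)" for p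
  proof (cases "p < P")
    case True
    have "H1 p c < b1 * w1" for c
    proof -
      have "card (U2 \<inter> nbrs c) \<le> card (A2 \<inter> nbrs c)" using U2(1) fin by (intro card_mono) auto
      then show ?thesis using cTA[of c] cQ[OF True, of c] win1(2) unfolding H1_def by linarith
    qed
    then show ?thesis using exists_window[of X b1 "H1 p" w1 z1] fin win1 by blast
  qed auto
  then obtain Xp where Xp: "\<And>p. p < P \<Longrightarrow> Xp p \<subseteq> X" "\<And>p. p < P \<Longrightarrow> card (Xp p) = z1"
      "\<And>p c c'. p < P \<Longrightarrow> c \<in> Xp p \<Longrightarrow> c' \<in> Xp p \<Longrightarrow> H1 p c \<le> H1 p c' + w1"
    by metis
  define S where "S p j = a p ` {..<j} \<union> b p ` {j..<M}" for p j
  \<comment> \<open>The degree without the contribution of \<open>U1\<close>. It varies with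
    \<open>q\<close> and \<open>j\<close>, so one \<open>U1\<close> has to be good for half of all
    triples, although the windows \<open>Xp\<close> depend on \<open>p\<close> alone.\<close>
  define s1 where "s1 i x = (case i of (p, q, j) \<Rightarrow>
      card (Q (J * p + q) \<inter> nbrs x) + card (U2 \<inter> nbrs x) + card (S p j \<inter> nbrs x))" for i x
  define I where "I = G \<times> {..<L} \<times> {..<M}"
  have finI: "finite I" using G(2) by (simp add: I_def)
  have XpI: "Xp (fst i) \<subseteq> X" "card (Xp (fst i)) = z1" if "i \<in> I" for i
    using that Xp(1,2) G(3) by (fastforce simp: I_def)+
  have "4 * real (card (C \<union> X)) * exp (- ((real \<delta>1)\<^sup>2 / (4 * real (card A1))))
      \<le> 1"
    using cCX by (intro order.trans[OF _ dev1(3)] mult_right_mono) auto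
  then have "\<exists>U1\<subseteq>A1. (\<forall>v\<in>C \<union> X. \<bar>2 * real (card (U1 \<inter> nbrs v)) - real (card (A1 \<inter> nbrs v))\<bar> \<le> real \<delta>1) \<and>
      card I \<le> 2 * card {i \<in> I. z1 \<le> 8 * \<sigma> * card ((\<lambda>x. s1 i x + 1 * card (U1 \<inter> nbrs x)) ` Xp (fst i))}"
    using fin finI pos twins1 XpI win1 dev1
    by (intro exists_concentrated_subset_many_values[where X = X and z = z1 and t = t1]) auto
  then obtain U1 where U1: "U1 \<subseteq> A1"
      "\<And>v. v \<in> C \<union> X \<Longrightarrow> \<bar>2 * real (card (U1 \<inter> nbrs v)) - real (card (A1 \<inter> nbrs v))\<bar> \<le> real \<delta>1"
      "card I \<le> 2 * card {i \<in> I. z1 \<le> 8 * \<sigma> * card ((\<lambda>x. s1 i x + card (U1 \<inter> nbrs x)) ` Xp (fst i))}"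
    by auto
  define U where "U = U1 \<union> U2"
  define I' where "I' = {i \<in> I. z1 \<le> 8 * \<sigma> * card ((\<lambda>x. s1 i x + card (U1 \<inter> nbrs x)) ` Xp (fst i))}"
  have finU: "finite U1" "finite U2" using U1(1) U2(1) fin finite_subset by blast+
  have cU: "card (U \<inter> nbrs v) = card (U1 \<inter> nbrs v) + card (U2 \<inter> nbrs v)" for v
    unfolding U_def using finU U1(1) U2(1) disj by (intro card_Un_inter_nbrs) auto
  have UV: "U \<subseteq> A1 \<union> A2" "finite U" using U1(1) U2(1) finU by (auto simp: U_def)
  have UT: "U \<inter> T = {}" "C \<inter> U = {}" "X \<inter> U = {}"
    using UV(1) disj(1,2) disj(6,7) disj(8,9) by auto
  \<comment> \<open>In doubled degrees, replacing the expectation by the actual \<open>U1\<close>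
    costs \<open>\<delta>1\<close>.\<close>
  have D: "2 * card ((Q (J * p) \<union> U) \<inter> nbrs v) \<le> H1 p v + \<delta>1 \<and>
      H1 p v \<le> 2 * card ((Q (J * p) \<union> U) \<inter> nbrs v) + \<delta>1" if "p < P" "v \<in> C \<union> X" for p v
  proof -
    have "card ((Q (J * p) \<union> U) \<inter> nbrs v) = card (Q (J * p) \<inter> nbrs v) + card (U \<inter> nbrs v)"
    proof (rule card_Un_inter_nbrs)
      show "finite (Q (J * p))" using finQ[of p 0] that by simp
      show "Q (J * p) \<inter> U = {}" using QT[of p 0] that UT(1) by auto
    qed (rule UV(2))
    moreover have "2 * card (U1 \<inter> nbrs v) \<le> card (A1 \<inter> nbrs v) + \<delta>1"
        "card (A1 \<inter> nbrs v) \<le> 2 * card (U1 \<inter> nbrs v) + \<delta>1"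
      using U1(2)[OF that(2)] by (auto simp: abs_le_iff; linarith)+
    ultimately show ?thesis unfolding H1_def cU by linarith
  qed
  have "(\<Sum>(p, q, j)\<in>I'. card ((\<lambda>x. card ((Q (J * p + q) \<union> U \<union> S p j) \<inter> nbrs x)) ` Xp p))
      \<le> card (\<Phi> V E)"
    unfolding S_def
  proof (rule sum_card_values_le_card_induced_sizes[where Q = Q and K = K and d = d and T = T
        and C = C and X = X and n = n and G = G and L = L and P = P
        and r = "w1 + 2 * \<delta>1 + 2 * L + 2 * M + 1" and W = "w2 + 2 * \<delta>2 + 2 * \<delta>1" and \<omega> = "w1 + 2 * \<delta>1"])
    show "U \<subseteq> V" using UV sub by auto
    have "T \<union> U \<union> C \<union> X \<subseteq> T \<union> A1 \<union> A2 \<union> C \<union> X" using UV by auto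
    then have "card (T \<union> U \<union> C \<union> X) \<le> card (T \<union> A1 \<union> A2 \<union> C \<union> X)"
      using fin by (intro card_mono) auto
    then show "card (T \<union> U \<union> C \<union> X) \<le> n" using n by linarith
    show "p \<in> G \<and> q < L \<and> j < M" if "(p, q, j) \<in> I'" for p q j
      using that by (auto simp: I'_def I_def)
    show "finite I'" using G(2) by (auto simp: I'_def I_def)
    show "a p j \<in> C \<and> b p j \<in> C \<and>
        card ((Q (J * p) \<union> U) \<inter> nbrs (b p j)) + (w1 + 2 * \<delta>1 + 2 * L + 2 * M + 1)
          \<le> card ((Q (J * p) \<union> U) \<inter> nbrs (a p j)) \<and>
        card ((Q (J * p) \<union> U) \<inter> nbrs (a p j))
          \<le> card ((Q (J * p) \<union> U) \<inter> nbrs (b p j)) + (w2 + 2 * \<delta>2 + 2 * \<delta>1)"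
      if "p \<in> G" "j < M" for p j
    proof -
      have p: "p < P" using G(3) that by simp
      have C: "a p j \<in> C" "b p j \<in> C" using abC(1,2)[OF that] Cp(1)[OF p] by auto
      have D': "2 * card ((Q (J * p) \<union> U) \<inter> nbrs (a p j)) \<le> H1 p (a p j) + \<delta>1"
          "H1 p (a p j) \<le> 2 * card ((Q (J * p) \<union> U) \<inter> nbrs (a p j)) + \<delta>1"
          "2 * card ((Q (J * p) \<union> U) \<inter> nbrs (b p j)) \<le> H1 p (b p j) + \<delta>1"
          "H1 p (b p j) \<le> 2 * card ((Q (J * p) \<union> U) \<inter> nbrs (b p j)) + \<delta>1"
        using D[OF p] C by auto
      have "H1 p (b p j) + R \<le> H1 p (a p j)" "H1 p (a p j) \<le> H1 p (b p j) + (w2 + 2 * \<delta>2)"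
        using abC(3)[OF that] F2_window[OF p abC(1,2)[OF that]] by (simp_all add: F2_eq)
      \<comment> \<open>The gap \<open>R\<close> in doubled degrees loses \<open>\<delta>1\<close>
        at either end; by \<open>num(3)\<close> enough is left after halving.\<close>
      then have "2 * card ((Q (J * p) \<union> U) \<inter> nbrs (b p j)) + R
          \<le> 2 * card ((Q (J * p) \<union> U) \<inter> nbrs (a p j)) + 2 * \<delta>1"
        "2 * card ((Q (J * p) \<union> U) \<inter> nbrs (a p j))
          \<le> 2 * card ((Q (J * p) \<union> U) \<inter> nbrs (b p j)) + (w2 + 2 * \<delta>2 + 2 * \<delta>1)"
        using D' by simp_all
      then show ?thesis using C num(3) by auto
    qed
    show "card ((Q (J * p) \<union> U) \<inter> nbrs x) \<le> card ((Q (J * p) \<union> U) \<inter> nbrs x') + (w1 + 2 * \<delta>1)"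
      if "p \<in> G" "x \<in> Xp p" "x' \<in> Xp p" for p x x'
    proof -
      have p: "p < P" using G(3) that by simp
      have "x \<in> C \<union> X" "x' \<in> C \<union> X" using Xp(1)[OF p] that by auto
      from D[OF p this(1), THEN conjunct1] D[OF p this(2), THEN conjunct2] Xp(3)[OF p that(2,3)]
      show ?thesis by linarith
    qed
    show "Xp p \<subseteq> X" if "p \<in> G" for p using Xp(1) G(3) that by blast
  qed (use chain sub disj UT G inj num in auto)
  moreover have "z1 * card I' \<le> 8 * \<sigma> *
      (\<Sum>(p, q, j)\<in>I'. card ((\<lambda>x. card ((Q (J * p + q) \<union> U \<union> S p j) \<inter> nbrs x)) ` Xp p))"
  proof -
    have "z1 * card I' = (\<Sum>i\<in>I'. z1)" by simp
    also have "\<dots> \<le> (\<Sum>(p, q, j)\<in>I'. 8 * \<sigma> *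
        card ((\<lambda>x. card ((Q (J * p + q) \<union> U \<union> S p j) \<inter> nbrs x)) ` Xp p))"
    proof (rule sum_mono)
      fix i assume i: "i \<in> I'"
      obtain p q j where ieq: "i = (p, q, j)" by (metis prod_cases3)
      have pqj: "p < P" "q < L" "j < M" "p \<in> G" using i ieq G(3) by (auto simp: I'_def I_def)
      have SC: "S p j \<subseteq> C" using abC(1,2)[OF pqj(4)] Cp(1)[OF pqj(1)] pqj(3) by (auto simp: S_def)
      have finS: "finite (S p j)" by (simp add: S_def)
      have "card ((Q (J * p + q) \<union> U \<union> S p j) \<inter> nbrs x) = s1 i x + card (U1 \<inter> nbrs x)" for x
      proof -
        have "card ((Q (J * p + q) \<union> U \<union> S p j) \<inter> nbrs x)
            = card (Q (J * p + q) \<inter> nbrs x) + card (U \<inter> nbrs x) + card (S p j \<inter> nbrs x)"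
        proof -
          have "Q (J * p + q) \<inter> U = {}" "(Q (J * p + q) \<union> U) \<inter> S p j = {}"
            using QT[of p q] pqj UT SC disj(3) by auto
          then show ?thesis using finQ[of p q] pqj UV(2) finS by (simp add: card_Un_inter_nbrs)
        qed
        then show ?thesis by (simp add: s1_def ieq cU)
      qed
      then show "z1 \<le> (case i of (p, q, j) \<Rightarrow> 8 * \<sigma> *
          card ((\<lambda>x. card ((Q (J * p + q) \<union> U \<union> S p j) \<inter> nbrs x)) ` Xp p))"
        using i by (simp add: ieq I'_def)
    qed
    also have "\<dots> = 8 * \<sigma> *
        (\<Sum>(p, q, j)\<in>I'. card ((\<lambda>x. card ((Q (J * p + q) \<union> U \<union> S p j) \<inter> nbrs x)) ` Xp p))"
      by (simp add: sum_distrib_left case_prod_unfold)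
    finally show ?thesis .
  qed
  ultimately have z: "z1 * card I' \<le> 8 * \<sigma> * card (\<Phi> V E)"
    by (meson le_trans mult_le_mono2)
  have "card I = card G * (L * M)" by (simp add: I_def card_cartesian_product)
  then have "card G * (L * M) \<le> 2 * card I'" using U1(3) by (simp add: I'_def)
  moreover have "P * (L * M) \<le> 2 * card G * (L * M)" using G(1) by (rule mult_le_mono1)
  ultimately have "P * (L * M) \<le> 4 * card I'" by linarith
  then have "P * (L * M) * z1 \<le> 4 * card I' * z1" by (rule mult_le_mono1)
  also have "\<dots> \<le> 4 * (8 * \<sigma> * card (\<Phi> V E))" using z by (simp add: mult.commute mult.left_commute)
  finally show ?thesis by (simp add: mult.assoc)
qed

text \<open>
  With \<open>m = k + 22\<close> all parameters are powers of \<open>y\<close>, where \<open>y ^ (2 * m)\<close> is about the number of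
  vertices; the exponents are chosen so that each requirement of the previous lemma holds with
  at least one factor \<open>y\<close> to spare.
\<close>

lemma power_le_card_induced_sizes:
  assumes y: "64 \<le> y" "8 ^ (2 * a) \<le> y" "h < y"
    and exp: "12 * real y ^ (2 * k + 44) * exp (- ((real y)\<^sup>2 / 4)) \<le> 1"
    and cV: "3 * y ^ (2 * k + 44) \<le> card V"
    and both: "\<And>S. S \<subseteq> V \<Longrightarrow> card S = y \<Longrightarrow>
      (\<exists>K\<subseteq>S. card K = c \<and> clique K E) \<and> (\<exists>I\<subseteq>S. card I = c \<and> indep I E)"
    and hom: "\<And>K. K \<subseteq> V \<Longrightarrow> clique K E \<or> indep K E \<Longrightarrow> card K \<le> h" and ac: "h < a * c"
  shows "y ^ (4 * k + 54) \<le> card (\<Phi> V E)"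
proof -
  define N where "N = y ^ (2 * k + 44)"
  have y0: "0 < y" using y by simp
  have pp: "y ^ i * y ^ j = y ^ l" if "i + j = l" for i j l
    using that by (simp flip: power_add)
  have ps: "y * y ^ i = y ^ l" if "Suc i = l" for i l
    using that by (simp flip: power_Suc)
  have p2: "(y ^ i)\<^sup>2 = y ^ l" if "2 * i = l" for i l
    using that by (simp add: mult.commute flip: power_mult)
  \<comment> \<open>Three disjoint pieces: \<open>V3\<close> carries the chain, \<open>V2\<close>
    contains \<open>C\<close> and \<open>A2\<close>, and the smaller \<open>V1\<close> contains
    \<open>X\<close> and \<open>A1\<close>. The size of \<open>V1\<close> keeps the fluctuation
    \<open>y ^ (k + 16)\<close> due to \<open>U1\<close> well below the swap gap
    \<open>y ^ (k + 18)\<close>.\<close>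
  obtain V3 where V3: "V3 \<subseteq> V" "card V3 = N" "finite V3"
    using obtain_subset_with_card_n[of N V] cV by (metis N_def le_trans mult_le_mono1 nat_mult_1 one_le_numeral)
  have "card (V - V3) = card V - N" using V3 by (simp add: card_Diff_subset)
  then have "2 * N \<le> card (V - V3)" using cV by (simp add: N_def)
  then obtain V2 where V2: "V2 \<subseteq> V - V3" "card V2 = N" "finite V2"
    using obtain_subset_with_card_n[of N "V - V3"] by (metis le_trans mult_2 le_add1)
  have "card (V - V3 - V2) = card (V - V3) - N" using V2 by (simp add: card_Diff_subset)
  then have "N \<le> card (V - V3 - V2)" using \<open>2 * N \<le> card (V - V3)\<close> by simp
  moreover have N1: "y ^ (2 * k + 30) \<le> N" unfolding N_def using y0 by (intro power_increasing) auto
  ultimately obtain V1 where V1: "V1 \<subseteq> V - V3 - V2" "card V1 = y ^ (2 * k + 30)" "finite V1"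
    using obtain_subset_with_card_n[of "y ^ (2 * k + 30)" "V - V3 - V2"] by (metis le_trans)
  let ?sd = "\<lambda>x x'. sym_diff (nbrs x) (nbrs x')"
  \<comment> \<open>The near-twin threshold is one factor \<open>y\<close> below the size required
    of \<open>A\<close>, because the differences of \<open>y\<close> twins are deleted
    together.\<close>
  have "\<exists>X A. X \<subseteq> V1 \<and> A \<subseteq> V1 \<and> X \<inter> A = {} \<and> y ^ (2 * k + 29) \<le> card X \<and> y ^ (2 * k + 29) \<le> card A \<and>
    (\<forall>x\<in>X. card {x' \<in> X. card (A \<inter> ?sd x x') < (y ^ (k + 14))\<^sup>2} \<le> y)"
  proof (rule exists_diverse_pair[OF both, where a = a and h = h])
    show "y * (y ^ (k + 14))\<^sup>2 \<le> 2 * y ^ (2 * k + 29)"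
      using ps[of "2 * k + 28" "2 * k + 29"] p2[of "k + 14" "2 * k + 28"] by simp
    show "8 ^ (2 * a) * y ^ (2 * k + 29) \<le> card V1"
      unfolding V1 using y y0 by (intro mult_power_le_power) auto
  qed (use V1 hom ac in auto)
  then obtain X A1 where X: "X \<subseteq> V1" "A1 \<subseteq> V1" "X \<inter> A1 = {}" "y ^ (2 * k + 29) \<le> card X"
      "y ^ (2 * k + 29) \<le> card A1"
      "\<And>x. x \<in> X \<Longrightarrow> card {x' \<in> X. card (A1 \<inter> ?sd x x') < (y ^ (k + 14))\<^sup>2} \<le> y" by auto
  have "\<exists>X A. X \<subseteq> V2 \<and> A \<subseteq> V2 \<and> X \<inter> A = {} \<and> y ^ (2 * k + 43) \<le> card X \<and> y ^ (2 * k + 43) \<le> card A \<and>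
    (\<forall>x\<in>X. card {x' \<in> X. card (A \<inter> ?sd x x') < (y ^ (k + 21))\<^sup>2} \<le> y)"
  proof (rule exists_diverse_pair[OF both, where a = a and h = h])
    show "y * (y ^ (k + 21))\<^sup>2 \<le> 2 * y ^ (2 * k + 43)"
      using ps[of "2 * k + 42" "2 * k + 43"] p2[of "k + 21" "2 * k + 42"] by simp
    show "8 ^ (2 * a) * y ^ (2 * k + 43) \<le> card V2"
      unfolding V2 N_def using y y0 by (intro mult_power_le_power) auto
  qed (use V2 hom ac in auto)
  then obtain C A2 where C: "C \<subseteq> V2" "A2 \<subseteq> V2" "C \<inter> A2 = {}" "y ^ (2 * k + 43) \<le> card C"
      "y ^ (2 * k + 43) \<le> card A2"
      "\<And>x. x \<in> C \<Longrightarrow> card {x' \<in> C. card (A2 \<inter> ?sd x x') < (y ^ (k + 21))\<^sup>2} \<le> y" by auto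
  \<comment> \<open>Independent sets have fewer than \<open>y\<close> vertices, so degrees of
    \<open>y ^ (2 * k + 42)\<close> are available as long as \<open>y ^ (2 * k + 43)\<close>
    vertices remain; the chain uses up all the others.\<close>
  have "\<exists>Q :: nat \<Rightarrow> 'a set. (\<forall>i\<le>N - y ^ (2 * k + 43). Q i \<subseteq> V3) \<and>
    (\<forall>i<N - y ^ (2 * k + 43). \<exists>v. v \<notin> Q i \<and> Q (Suc i) = insert v (Q i) \<and>
      y ^ (2 * k + 42) \<le> card (Q i \<inter> nbrs v))"
  proof (rule exists_chain_of_large_degrees)
    show "\<exists>v\<in>W. y ^ (2 * k + 42) \<le> card (W \<inter> nbrs v)"
      if "W \<subseteq> V3" "y ^ (2 * k + 43) \<le> card W" for W
    proof (rule exists_large_degree)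
      have "h * y ^ (2 * k + 42) < y * y ^ (2 * k + 42)" using y y0 by simp
      also have "\<dots> = y ^ (2 * k + 43)" by (rule ps) simp
      finally show "h * y ^ (2 * k + 42) < card W" using that by simp
    qed (use that V3 hom in auto)
    have "y ^ (2 * k + 43) \<le> N" unfolding N_def using y0 by (intro power_increasing) auto
    then show "N - y ^ (2 * k + 43) + y ^ (2 * k + 43) \<le> card V3" using V3 by simp
  qed (use V3 y0 in auto)
  then obtain Q :: "nat \<Rightarrow> 'a set" where Q: "\<And>i. i \<le> N - y ^ (2 * k + 43) \<Longrightarrow> Q i \<subseteq> V3"
      "\<And>i. i < N - y ^ (2 * k + 43) \<Longrightarrow> \<exists>v. v \<notin> Q i \<and> Q (Suc i) = insert v (Q i) \<and>
        y ^ (2 * k + 42) \<le> card (Q i \<inter> nbrs v)" by auto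
  have cA: "card A1 \<le> y ^ (2 * k + 30)" "card A2 \<le> N"
    using card_mono[OF V1(3) X(2)] card_mono[OF V2(3) C(2)] V1(2) V2(2) by auto
  \<comment> \<open>A deviation of at least \<open>y * sqrt \<alpha>\<close> makes the tail exponent
    at least \<open>y\<^sup>2 / 4\<close>, enough for a union bound over \<open>3 * N\<close>
    vertices.\<close>
  have dev: "4 * real (3 * N) * exp (- ((real \<delta>)\<^sup>2 / (4 * real \<alpha>))) \<le> 1"
    if "0 < \<alpha>" "\<alpha> * y\<^sup>2 \<le> \<delta>\<^sup>2" for \<alpha> \<delta> :: nat
  proof -
    have "real (\<alpha> * y\<^sup>2) \<le> real (\<delta>\<^sup>2)" using that(2) by (rule of_nat_mono)
    then have "(real y)\<^sup>2 / 4 \<le> (real \<delta>)\<^sup>2 / (4 * real \<alpha>)"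
      using that(1) by (simp add: field_simps)
    then have "4 * real (3 * N) * exp (- ((real \<delta>)\<^sup>2 / (4 * real \<alpha>)))
        \<le> 4 * real (3 * N) * exp (- ((real y)\<^sup>2 / 4))"
      by (intro mult_left_mono) auto
    also have "\<dots> \<le> 1" using exp by (simp add: N_def)
    finally show ?thesis .
  qed
  have pw: "i \<le> j \<Longrightarrow> y ^ i \<le> y ^ j" for i j using y0 by (intro power_increasing) auto
  note mp = mult_power_le_power[OF _ y0]
  \<comment> \<open>The factors are \<open>P\<close>, \<open>L\<close>, \<open>M\<close> and the
    window size \<open>z1\<close>; on the right \<open>\<sigma>\<close> is \<open>y\<close>.\<close>
  have "y ^ (k + 27) * y ^ (k + 16) * y ^ (k + 13) * y ^ k \<le> 32 * y * card (\<Phi> V E)"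
  proof (rule card_induced_sizes_ge[where Q = Q and K = "N - y ^ (2 * k + 43)" and d = "y ^ (2 * k + 42)"
        and T = V3 and ?A1.0 = A1 and ?A2.0 = A2 and C = C and X = X and n = "3 * N"
        and ?t1.0 = "y ^ (k + 14)" and ?t2.0 = "y ^ (k + 21)"
        and ?b1.0 = "y ^ (k + 29)" and ?w1.0 = "y ^ (k + 16)" and ?b2.0 = "y ^ (k + 23)"
        and ?w2.0 = "y ^ (k + 22)" and ?z2.0 = "y ^ (k + 20)" and R = "y ^ (k + 18)"
        and ?\<delta>1.0 = "y ^ (k + 16)" and ?\<delta>2.0 = "y ^ (k + 23)" and J = "2 * y ^ (k + 16)"])
    show "card (V3 \<union> A1 \<union> A2 \<union> C \<union> X) \<le> 3 * N"
    proof -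
      have "card (V3 \<union> A1 \<union> A2 \<union> C \<union> X) \<le> card (V3 \<union> V1 \<union> V2)"
        using X C V1 V2 V3 by (intro card_mono) auto
      also have "\<dots> \<le> card V3 + card V1 + card V2"
        by (meson add_le_mono card_Un_le le_refl le_trans)
      finally show ?thesis using V1 V2 V3 N1 by simp
    qed
    have six: "6 * N < y ^ (2 * k + 45)"
    proof -
      have "6 * N < y * N" using y y0 by (simp add: N_def)
      also have "\<dots> = y ^ (2 * k + 45)" unfolding N_def by (rule ps) simp
      finally show ?thesis .
    qed
    show "2 * (3 * N) < y ^ (k + 29) * y ^ (k + 16)" "2 * (3 * N) < y ^ (k + 23) * y ^ (k + 22)"
      using six pp[of "k + 29" "k + 16" "2 * k + 45"] pp[of "k + 23" "k + 22" "2 * k + 45"] by simp_all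
    show "y ^ k * y ^ (k + 29) \<le> card X" "y ^ (k + 20) * y ^ (k + 23) \<le> card C"
      using X(4) C(4) pp[of k "k + 29" "2 * k + 29"] pp[of "k + 20" "k + 23" "2 * k + 43"] by simp_all
    show "y ^ k \<le> y * y ^ (k + 14)" "y ^ (k + 20) \<le> y * y ^ (k + 21)"
      using pw[of k "k + 15"] pw[of "k + 20" "k + 22"] ps[of "k + 14" "k + 15"] ps[of "k + 21" "k + 22"]
      by simp_all
    show "8 * y * (2 * y ^ (k + 13) + y ^ (k + 18)) \<le> y ^ (k + 20)"
    proof -
      have "8 * y * (2 * y ^ (k + 13) + y ^ (k + 18)) \<le> 8 * y * (3 * y ^ (k + 18))"
        using pw[of "k + 13" "k + 18"] by (intro mult_le_mono) auto
      also have "\<dots> = 24 * y ^ (k + 19)" using ps[of "k + 18" "k + 19"] by simp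
      also have "\<dots> \<le> y ^ (k + 20)" using y by (intro mp) auto
      finally show ?thesis .
    qed
    show "y ^ (k + 16) \<le> card A1" "y ^ (k + 23) \<le> card A2"
      using X(5) C(5) pw[of "k + 16" "2 * k + 29"] pw[of "k + 23" "2 * k + 43"] by linarith+
    have "0 < card A1" "0 < card A2" using X(5) C(5) y0 by (metis gr0I le_zero_eq zero_less_power less_irrefl)+
    moreover have "card A1 * y\<^sup>2 \<le> y ^ (2 * k + 30) * y\<^sup>2" "card A2 * y\<^sup>2 \<le> N * y\<^sup>2"
      using cA by (intro mult_le_mono1; simp)+
    moreover have "y ^ (2 * k + 30) * y\<^sup>2 = (y ^ (k + 16))\<^sup>2" "N * y\<^sup>2 = (y ^ (k + 23))\<^sup>2"
      unfolding N_def using pp[of "2 * k + 30" 2 "2 * k + 32"] p2[of "k + 16" "2 * k + 32"]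
        pp[of "2 * k + 44" 2 "2 * k + 46"] p2[of "k + 23" "2 * k + 46"] by simp_all
    ultimately show "4 * real (3 * N) * exp (- ((real (y ^ (k + 16)))\<^sup>2 / (4 * real (card A1)))) \<le> 1"
        "4 * real (3 * N) * exp (- ((real (y ^ (k + 23)))\<^sup>2 / (4 * real (card A2)))) \<le> 1"
      by (intro dev; simp)+
    show "2 * y ^ (k + 16) * y ^ (k + 27) \<le> N - y ^ (2 * k + 43)"
    proof -
      have "2 * y ^ (k + 16) * y ^ (k + 27) + y ^ (2 * k + 43) = 3 * y ^ (2 * k + 43)"
        using pp[of "k + 16" "k + 27" "2 * k + 43"] by simp
      also have "\<dots> \<le> N" unfolding N_def using y by (intro mp) auto
      finally show ?thesis by linarith
    qed
    show "2 * (y ^ (k + 16) + 2 * y ^ (k + 16) + 2 * y ^ (k + 16) + 2 * y ^ (k + 13) + 1) + 2 * y ^ (k + 16)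
        \<le> y ^ (k + 18)"
    proof -
      have "2 * (y ^ (k + 16) + 2 * y ^ (k + 16) + 2 * y ^ (k + 16) + 2 * y ^ (k + 13) + 1) + 2 * y ^ (k + 16)
          \<le> 18 * y ^ (k + 16)"
        using pw[of "k + 13" "k + 16"] pw[of 0 "k + 16"] by simp
      also have "\<dots> \<le> y ^ (k + 18)" using y by (intro mp) auto
      finally show ?thesis .
    qed
    show "y ^ (k + 13) * (y ^ (k + 22) + 2 * y ^ (k + 23) + 2 * y ^ (k + 16) + y ^ (k + 16) + y ^ (k + 13))
        + y ^ (k + 16) + 2 * y ^ (k + 16) + y ^ (k + 16) + y ^ (k + 13) < y ^ (2 * k + 42)"
    proof -
      have "y ^ (k + 22) + 2 * y ^ (k + 23) + 2 * y ^ (k + 16) + y ^ (k + 16) + y ^ (k + 13)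
          \<le> 7 * y ^ (k + 23)"
        using pw[of "k + 22" "k + 23"] pw[of "k + 16" "k + 23"] pw[of "k + 13" "k + 23"] by simp
      then have "y ^ (k + 13) * (y ^ (k + 22) + 2 * y ^ (k + 23) + 2 * y ^ (k + 16) + y ^ (k + 16) + y ^ (k + 13))
          \<le> y ^ (k + 13) * (7 * y ^ (k + 23))" by (rule mult_le_mono2)
      also have "\<dots> = 7 * y ^ (2 * k + 36)" using pp[of "k + 13" "k + 23" "2 * k + 36"] by simp
      finally have "y ^ (k + 13) * (y ^ (k + 22) + 2 * y ^ (k + 23) + 2 * y ^ (k + 16) + y ^ (k + 16) + y ^ (k + 13))
        + y ^ (k + 16) + 2 * y ^ (k + 16) + y ^ (k + 16) + y ^ (k + 13) < 13 * y ^ (2 * k + 36)"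
        using pw[of "k + 16" "2 * k + 36"] pw[of "k + 13" "2 * k + 36"] y0
          zero_less_power[OF y0, of "2 * k + 36"] by linarith
      also have "\<dots> \<le> y ^ (2 * k + 42)" using y by (intro mp) auto
      finally show ?thesis .
    qed
    \<comment> \<open>As \<open>J\<close> is twice \<open>L\<close>, positions in different blocks
      stay \<open>y ^ (k + 16)\<close> chain steps apart.\<close>
    show "(y ^ (k + 13) + 1) * (3 * N) < (2 * y ^ (k + 16) - y ^ (k + 16)) * y ^ (2 * k + 42)"
    proof -
      have "(y ^ (k + 13) + 1) * (3 * N) \<le> (2 * y ^ (k + 13)) * (3 * N)"
        using pw[of 0 "k + 13"] by (intro mult_le_mono1) simp
      also have "\<dots> = 6 * y ^ (3 * k + 57)" unfolding N_def using pp[of "k + 13" "2 * k + 44" "3 * k + 57"] by simp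
      also have "\<dots> < 7 * y ^ (3 * k + 57)" using y0 by simp
      also have "\<dots> \<le> y ^ (3 * k + 58)" using y by (intro mp) auto
      also have "\<dots> = (2 * y ^ (k + 16) - y ^ (k + 16)) * y ^ (2 * k + 42)"
        using pp[of "k + 16" "2 * k + 42" "3 * k + 58"] by simp
      finally show ?thesis .
    qed
    show "V3 \<subseteq> V" "A1 \<subseteq> V" "A2 \<subseteq> V" "C \<subseteq> V" "X \<subseteq> V" using V1 V2 V3 X C by auto
    show "A1 \<inter> V3 = {}" "A2 \<inter> V3 = {}" "C \<inter> V3 = {}" "X \<inter> V3 = {}" "A1 \<inter> A2 = {}"
      "C \<inter> A1 = {}" "C \<inter> A2 = {}" "X \<inter> A1 = {}" "X \<inter> A2 = {}" "X \<inter> C = {}"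
      using V1(1) V2(1) X(1,2,3) C(1,2,3) by blast+
  qed (use Q X(6) C(6) y0 in auto)
  also have "y ^ (k + 27) * y ^ (k + 16) * y ^ (k + 13) * y ^ k = y * (y * y ^ (4 * k + 54))"
    using pp[of "k + 27" "k + 16" "2 * k + 43"] pp[of "2 * k + 43" "k + 13" "3 * k + 56"]
      pp[of "3 * k + 56" k "4 * k + 56"] ps[of "4 * k + 54" "4 * k + 55"]
      ps[of "4 * k + 55" "4 * k + 56"] by simp
  finally have "y * y ^ (4 * k + 54) \<le> 32 * card (\<Phi> V E)" using y0 by simp
  moreover have "32 * y ^ (4 * k + 54) \<le> y * y ^ (4 * k + 54)" using y by (intro mult_le_mono1) simp
  ultimately have "32 * y ^ (4 * k + 54) \<le> 32 * card (\<Phi> V E)" by (rule le_trans[rotated])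
  then show ?thesis by simp
qed

end

section \<open>Choice of the parameters\<close>

text \<open>
  The bases \<open>1/x\<close> and \<open>1/(1-x)\<close> of the Ramsey weight are balanced so that each factor is at most a
  constant times \<open>y powr (1/4)\<close>: first \<open>x\<close> is taken small, then \<open>a\<close> large.
\<close>

lemma exists_ramsey_parameters:
  fixes D :: real and m :: nat
  assumes "D > 0"
  shows "\<exists>x a Y. 0 < x \<and> x < (1::real) \<and> 0 < a \<and> (\<forall>y\<ge>Y. 64 \<le> y \<and> 3 * 2 ^ m \<le> y \<and> 8 ^ (2 * a) \<le> y \<and>
      D * log 2 (real y) < real y \<and> 12 * real y ^ m * exp (- ((real y)\<^sup>2 / 4)) \<le> 1 \<and>
      (\<forall>h. real h \<le> D * log 2 (real y) \<longrightarrow>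
        (1 / x) ^ (h div a + 1) * (1 / (1 - x)) ^ (h + 1) \<le> real y + 1))"
proof -
  \<comment> \<open>Chosen so that \<open>\<beta> ^ h\<close> is at most
    \<open>y powr (1 / 4)\<close> whenever \<open>h \<le> D * log 2 y\<close>.\<close>
  define \<beta> :: real where "\<beta> = 2 powr (1 / (4 * D))"
  have \<beta>: "\<beta> > 1" using assms by (simp add: \<beta>_def)
  define x where "x = 1 - 1 / \<beta>"
  have x: "0 < x" "x < 1" "1 / (1 - x) = \<beta>" using \<beta> by (auto simp: x_def)
  define \<alpha> where "\<alpha> = 1 / x"
  have \<alpha>: "\<alpha> > 1" using x by (simp add: \<alpha>_def)
  \<comment> \<open>A large \<open>a\<close> tames the other factor:
    \<open>\<alpha> ^ (h div a)\<close> is then also at most \<open>y powr (1 / 4)\<close>.\<close>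
  obtain a :: nat where a: "4 * D * log 2 \<alpha> < real a" using reals_Archimedean2 by blast
  have "log 2 \<alpha> > 0" using \<alpha> by simp
  then have "0 < 4 * D * log 2 \<alpha>" using assms by simp
  then have a0: "0 < a" using a by (cases a) auto
  have ev1: "eventually (\<lambda>y::nat. 64 \<le> y \<and> 3 * 2 ^ m \<le> y \<and> 8 ^ (2 * a) \<le> y) sequentially"
    by (intro eventually_conj eventually_ge_at_top)
  have ev2: "eventually (\<lambda>y::nat. D * log 2 (real y) < real y) sequentially"
  proof -
    have "(\<lambda>y::nat. ln (real y) / real y) \<longlonglongrightarrow> 0"
      by (rule filterlim_compose[OF ln_x_over_x_tendsto_0 filterlim_real_sequentially])
    moreover have "ln 2 / D > (0::real)" using assms by simp
    ultimately have "eventually (\<lambda>y::nat. ln (real y) / real y < ln 2 / D) sequentially"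
      by (rule order_tendstoD)
    then show ?thesis using eventually_gt_at_top[of 0]
      by eventually_elim (use assms in \<open>simp add: log_def field_simps\<close>)
  qed
  have ev3: "eventually (\<lambda>y::nat. 12 * real y ^ m * exp (- ((real y)\<^sup>2 / 4)) \<le> 1) sequentially"
  proof -
    have "((\<lambda>z::real. z ^ m / exp z) \<longlongrightarrow> 0) at_top" by (rule tendsto_power_div_exp_0)
    then have "(\<lambda>y::nat. real y ^ m / exp (real y)) \<longlonglongrightarrow> 0"
      by (rule filterlim_compose) (rule filterlim_real_sequentially)
    then have "eventually (\<lambda>y::nat. real y ^ m / exp (real y) < 1 / 12) sequentially"
      by (rule order_tendstoD) simp
    then show ?thesis using eventually_ge_at_top[of 4]
    proof eventually_elim
      case (elim y)
      have "real y \<le> (real y)\<^sup>2 / 4" using elim by (simp add: power2_eq_square)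
      then have "exp (- ((real y)\<^sup>2 / 4)) \<le> exp (- real y)" by simp
      then have "12 * real y ^ m * exp (- ((real y)\<^sup>2 / 4)) \<le> 12 * real y ^ m * exp (- real y)"
        by (intro mult_left_mono) auto
      also have "\<dots> = 12 * (real y ^ m / exp (real y))" by (simp add: exp_minus field_simps)
      also have "\<dots> \<le> 1" using elim by simp
      finally show ?case .
    qed
  qed
  \<comment> \<open>Pays for the \<open>+ 1\<close> in both exponents: the extra factor
    \<open>\<alpha> * \<beta>\<close> is at most \<open>sqrt y\<close>, and the two fourth roots
    give the other \<open>sqrt y\<close>.\<close>
  have ev4: "eventually (\<lambda>y::nat. (\<alpha> * \<beta>)\<^sup>2 \<le> real y) sequentially"
    by (rule eventually_at_top_linorderI[of "nat \<lceil>(\<alpha> * \<beta>)\<^sup>2\<rceil>"]) linarith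
  have "eventually (\<lambda>y::nat. 64 \<le> y \<and> 3 * 2 ^ m \<le> y \<and> 8 ^ (2 * a) \<le> y \<and>
      D * log 2 (real y) < real y \<and> 12 * real y ^ m * exp (- ((real y)\<^sup>2 / 4)) \<le> 1 \<and>
      (\<forall>h. real h \<le> D * log 2 (real y) \<longrightarrow>
        (1 / x) ^ (h div a + 1) * (1 / (1 - x)) ^ (h + 1) \<le> real y + 1)) sequentially"
    using ev1 ev2 ev3 ev4
  proof eventually_elim
    case (elim y)
    have y: "real y > 0" using elim by simp
    have "(1 / x) ^ (h div a + 1) * (1 / (1 - x)) ^ (h + 1) \<le> real y + 1"
      if h: "real h \<le> D * log 2 (real y)" for h
    proof -
      have "\<alpha> ^ (h div a) = \<alpha> powr (real (h div a))" using \<alpha> by (simp add: powr_realpow)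
      also have "\<dots> = 2 powr (log 2 \<alpha> * real (h div a))" using \<alpha> by (simp flip: powr_powr)
      also have "\<dots> \<le> 2 powr (log 2 (real y) / 4)"
      proof (rule powr_mono)
        have "real (h div a) \<le> real h / real a" by (rule of_nat_div_le_of_nat)
        also have "\<dots> \<le> D * log 2 (real y) / real a" using h by (intro divide_right_mono) auto
        finally have "log 2 \<alpha> * real (h div a) \<le> log 2 \<alpha> * (D * log 2 (real y) / real a)"
          using \<open>log 2 \<alpha> > 0\<close> by (intro mult_left_mono) auto
        also have "\<dots> = (4 * D * log 2 \<alpha>) / real a * (log 2 (real y) / 4)" by simp
        also have "\<dots> \<le> 1 * (log 2 (real y) / 4)"
          using a a0 elim by (intro mult_right_mono) auto
        finally show "log 2 \<alpha> * real (h div a) \<le> log 2 (real y) / 4" by simp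
      qed simp
      also have "\<dots> = real y powr (1 / 4)" using y by (simp add: powr_def log_def)
      finally have 1: "\<alpha> ^ (h div a + 1) \<le> \<alpha> * real y powr (1 / 4)" using \<alpha> by simp
      have "\<beta> ^ h = 2 powr (real h / (4 * D))"
        using \<beta> by (simp add: \<beta>_def powr_powr flip: powr_realpow)
      also have "\<dots> \<le> 2 powr (log 2 (real y) / 4)"
        using h assms by (intro powr_mono) (auto simp: field_simps)
      also have "\<dots> = real y powr (1 / 4)" using y by (simp add: powr_def log_def)
      finally have 2: "\<beta> ^ (h + 1) \<le> \<beta> * real y powr (1 / 4)" using \<beta> by simp
      have "\<alpha> ^ (h div a + 1) * \<beta> ^ (h + 1)
          \<le> (\<alpha> * real y powr (1 / 4)) * (\<beta> * real y powr (1 / 4))"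
        using 1 2 \<alpha> \<beta> by (intro mult_mono) auto
      also have "\<dots> = (\<alpha> * \<beta>) * sqrt (real y)"
        using y by (simp add: powr_half_sqrt flip: powr_add)
      also have "\<dots> \<le> sqrt (real y) * sqrt (real y)"
        using elim by (intro mult_right_mono real_le_rsqrt) auto
      also have "\<dots> = real y" by simp
      finally show ?thesis using x(3) by (simp add: \<alpha>_def)
    qed
    then show ?case using elim by blast
  qed
  then show ?thesis using x a0 unfolding eventually_sequentially by blast
qed

section \<open>Rounding the number of vertices to a power, and the final exponent\<close>

text \<open>\<open>y\<close> is the integer part of the \<open>m\<close>-th root of
  \<open>n / 3\<close>; the factor 3 provides for the three pieces of the vertex set.\<close>

lemma exists_floor_root:
  fixes n Y m :: nat
  assumes "3 * Y ^ m \<le> n" "0 < m"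
  shows "\<exists>y\<ge>Y. 3 * y ^ m \<le> n \<and> n < 3 * (y + 1) ^ m"
proof -
  define y where "y = (LEAST z. n < 3 * (z + 1) ^ m)"
  \<comment> \<open>The witness \<open>n\<close> shows that the least element exists.\<close>
  have "n + 1 \<le> (n + 1) ^ m" using assms(2) by (intro self_le_power) auto
  then have "n < 3 * (n + 1) ^ m" by linarith
  then have less: "n < 3 * (y + 1) ^ m" unfolding y_def by (rule LeastI)
  have "3 * y ^ m \<le> n"
  proof (cases y)
    case (Suc z)
    then show ?thesis using not_less_Least[of z "\<lambda>z. n < 3 * (z + 1) ^ m"] by (simp add: y_def)
  qed (use assms(2) in \<open>simp add: zero_power\<close>)
  moreover have "Y \<le> y"
  proof (rule ccontr)
    assume "\<not> Y \<le> y"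
    then have "(y + 1) ^ m \<le> Y ^ m" by (intro power_mono) auto
    then show False using less assms(1) by linarith
  qed
  ultimately show ?thesis using less by blast
qed

theorem theorem1p3:
  fixes C \<epsilon> :: real
  assumes "C > 0" and "\<epsilon> > 0"
  shows "\<exists>n0. \<forall>n\<ge>n0. \<forall>(V :: 'a set) E.
    simple_graph V E \<and> card V = n \<and> ramsey_graph C V E \<longrightarrow>
      real (card (\<Phi> V E)) \<ge> real n powr (2 - \<epsilon>)"
proof -
  \<comment> \<open>Capping at 1 keeps \<open>2 - e\<close> nonnegative, so that the power is
    monotone in its base.\<close>
  define e where "e = min \<epsilon> 1"
  have e: "0 < e" "e \<le> 1" "e \<le> \<epsilon>" using assms by (auto simp: e_def)
  \<comment> \<open>As \<open>n\<close> will be at most \<open>y ^ (2 * k + 45)\<close>, the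
    exponent of \<open>y\<close> to be reached is \<open>4 * k + 90 - e * (2 * k + 45)\<close>. The
    available \<open>4 * k + 54\<close> suffices once the subtracted term is at least 36.\<close>
  obtain k :: nat where "18 / e < real k" using reals_Archimedean2 by blast
  then have k: "36 \<le> e * real (2 * k + 45)" using e by (simp add: field_simps)
  define m where "m = 2 * k + 44"
  \<comment> \<open>Converts the Ramsey bound in terms of \<open>log 2 n\<close> into one in terms
    of \<open>log 2 y\<close>, using \<open>n \<le> y ^ (m + 1)\<close>.\<close>
  define D where "D = C * real (m + 1)"
  have "D > 0" using assms by (simp add: D_def)
  then obtain x :: real and a Y :: nat where x: "0 < x" "x < 1" "0 < a" and Y: "\<And>y. Y \<le> y \<Longrightarrow>
      64 \<le> y \<and> 3 * 2 ^ m \<le> y \<and> 8 ^ (2 * a) \<le> y \<and>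
      D * log 2 (real y) < real y \<and> 12 * real y ^ m * exp (- ((real y)\<^sup>2 / 4)) \<le> 1 \<and>
      (\<forall>h. real h \<le> D * log 2 (real y) \<longrightarrow>
        (1 / x) ^ (h div a + 1) * (1 / (1 - x)) ^ (h + 1) \<le> real y + 1)"
    using exists_ramsey_parameters[of D m] by metis
  have "real n powr (2 - \<epsilon>) \<le> real (card (\<Phi> V E))"
    if n: "3 * Y ^ m \<le> n" and G: "simple_graph V E" "card V = n" "ramsey_graph C V E"
    for n and V :: "'a set" and E
  proof -
    interpret simple_graph V E by (rule G(1))
    obtain y where y: "Y \<le> y" "3 * y ^ m \<le> n" "n < 3 * (y + 1) ^ m"
      using exists_floor_root[OF n] by (auto simp: m_def)
    note y' = Y[OF y(1)]
    have y64: "64 \<le> y" using y' by simp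
    \<comment> \<open>One further factor \<open>y\<close> will absorb the rounding loss
      \<open>3 * 2 ^ m\<close>.\<close>
    have "n \<le> 3 * (2 * y) ^ m"
      using y(3) power_mono[of "y + 1" "2 * y" m] y64 by linarith
    also have "\<dots> = (3 * 2 ^ m) * y ^ m" by (simp add: power_mult_distrib)
    also have "\<dots> \<le> y * y ^ m" using y' by (intro mult_le_mono1) simp
    finally have ny: "n \<le> y ^ (m + 1)" by simp
    have n0: "0 < n" using y(2) y64 by (auto intro: ccontr)
    define h where "h = hom_number V E"
    have hom: "card K \<le> h" if "K \<subseteq> V" "clique K E \<or> indep K E" for K
    proof -
      have "{card S | S. homogeneous V E S} \<subseteq> card ` Pow V" by (auto simp: homogeneous_def)
      then have "finite {card S | S. homogeneous V E S}"
        using finite_verts by (meson finite_Pow_iff finite_imageI finite_subset)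
      moreover have "card K \<in> {card S | S. homogeneous V E S}"
        using that by (auto simp: homogeneous_def)
      ultimately show ?thesis unfolding h_def hom_number_def by (rule Max_ge)
    qed
    have h: "real h \<le> D * log 2 (real y)"
    proof -
      have "real h \<le> C * log 2 (real n)" using G by (simp add: h_def ramsey_graph_def)
      also have "\<dots> \<le> C * log 2 (real (y ^ (m + 1)))"
        using assms ny n0 by (intro mult_left_mono log_mono of_nat_mono) auto
      also have "\<dots> = D * log 2 (real y)"
        using y64 by (simp add: D_def log_nat_power del: power_Suc)
      finally show ?thesis .
    qed
    have "y ^ (4 * k + 54) \<le> card (\<Phi> V E)"
    \<comment> \<open>\<open>h div a + 1\<close> is the least \<open>c\<close> with
      \<open>h < a * c\<close>.\<close>
    proof (rule power_le_card_induced_sizes[where a = a and h = h and c = "h div a + 1"])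
      show "(\<exists>K\<subseteq>S. card K = h div a + 1 \<and> clique K E) \<and> (\<exists>I\<subseteq>S. card I = h div a + 1 \<and> indep I E)"
        if S: "S \<subseteq> V" "card S = y" for S
      proof (rule clique_and_indep_of_homogeneous_bounded[OF x(1,2)])
        show "(1 / x) ^ (h div a + 1) * (1 / (1 - x)) ^ (h + 1) \<le> real (card S) + 1"
          using y' h S by blast
      qed (use S hom finite_subset_verts in auto)
      show "h < a * (h div a + 1)" using x(3) dividend_less_times_div[of a h] by simp
      show "h < y" using h y' by linarith
      show "12 * real y ^ (2 * k + 44) * exp (- ((real y)\<^sup>2 / 4)) \<le> 1" using y' by (simp add: m_def)
      show "3 * y ^ (2 * k + 44) \<le> card V" using y G by (simp add: m_def)
    qed (use y' hom in auto)
    have "real n powr (2 - \<epsilon>) \<le> real n powr (2 - e)" using e n0 by (intro powr_mono) auto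
    also have "\<dots> \<le> real (y ^ (m + 1)) powr (2 - e)"
      using e ny by (intro powr_mono2 of_nat_mono) auto
    also have "\<dots> = real y powr (real (m + 1) * (2 - e))"
      using y64 by (simp add: powr_powr flip: powr_realpow del: power_Suc)
    also have "\<dots> \<le> real y powr (real (4 * k + 54))"
    proof (rule powr_mono)
      have "real (m + 1) * (2 - e) = real (4 * k + 90) - e * real (2 * k + 45)"
        by (simp add: m_def algebra_simps)
      then show "real (m + 1) * (2 - e) \<le> real (4 * k + 54)" using k by simp
    qed (use y64 in simp)
    also have "\<dots> = real (y ^ (4 * k + 54))" using y64 by (simp add: powr_realpow del: of_nat_add)
    also have "\<dots> \<le> real (card (\<Phi> V E))"
      using \<open>y ^ (4 * k + 54) \<le> card (\<Phi> V E)\<close> by (rule of_nat_mono)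
    finally show ?thesis .
  qed
  then show ?thesis by (intro exI[of _ "3 * Y ^ m"]) blast
qed

end
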